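(* Let $G$ be a directed graph with finite in-degrees, let $P_G$ be its graph inverse semigroup, let $CK_G=\mathsf{D}(P_G)/\!\equiv$, and let $\xi\colon P_G\to CK_G$ be $\xi(s)=[s^{\downarrow}]$. (1) $CK_G$ is a distributive inverse semigroup and $\xi$ is a homomorphism such that every element of $CK_G$ is a join of a finite non-empty compatible subset of the image of $\xi$. For each maximal idempotent $e$ of $P_G$, one has $\xi(e)=\bigvee_{f\in\hat e}\xi(f)$. The homomorphism $\xi$ is injective if and only if $G$ has the additional property that the in-degree of each vertex is either $0$ or at least $2$. (2) Let $\theta\colon P_G\to T$ be a homomorphism to a distributive inverse semigroup $T$ such that $\theta(e)=\bigvee_{f\in\hat e}\theta(f)$ for each maximal idempotent $e$ of $P_G$. Then there is a unique homomorphism of distributive inverse semigroups $\bar\theta\colon CK_G\to T$ such that $\bar\theta\,\xi=\theta$.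
   Context: Graph inverse semigroup: a directed graph $G$ has vertices $G_0$, edges $G_1$ and maps $\mathbf{d},\mathbf{r}\colon G_1\to G_0$. The in-degree of a vertex $v$ is the number of edges $x$ with $\mathbf{r}(x)=v$. A path is an empty path $1_v$ at a vertex $v$ or a sequence of edges $x_1\cdots x_n$ with $\mathbf{d}(x_i)=\mathbf{r}(x_{i+1})$; its range is $\mathbf{r}(x_1)$ and its domain is $\mathbf{d}(x_n)$ (both $v$ for $1_v$). $G^{*}$ is the set of paths under concatenation ($xy$ defined iff $\mathbf{d}(x)=\mathbf{r}(y)$). $P_G$ consists of $0$ and formal elements $xy^{-1}$ with $x,y\in G^{*}$, $\mathbf{d}(x)=\mathbf{d}(y)$, with product $xy^{-1}\cdot uv^{-1}=xzv^{-1}$ if $u=yz$; $=x(vz)^{-1}$ if $y=uz$; $=0$ otherwise. The maximal idempotents of $P_G$ are the elements $1_v1_v^{-1}$, $v\in G_0$. In $P_G$ any two elements have a meet $\wedge$ for the natural partial order $\le$. For an idempotent $e$ of $P_G$, $\hat e$ is the set of idempotents immediately covered by $e$, i.e. $f<e$ with no idempotent $g$ satisfying $f<g<e$. All inverse semigroups have a zero. Elements $s,t$ of an inverse semigroup are compatible if $s^{-1}t$ and $st^{-1}$ are idempotents, and orthogonal if $s^{-1}t=0=st^{-1}$. An inverse semigroup is distributive if every finite non-empty compatible subset has a join and multiplication distributes over those finite joins that exist. A homomorphism of distributive inverse semigroups is a homomorphism that preserves joins of finite non-empty compatible subsets. Construction of $CK_G$: for a subset $A$ of an inverse semigroup $S$,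 $A^{\downarrow}$ is the set of elements lying below some element of $A$; $s^{\downarrow}=\{s\}^{\downarrow}$. $\mathsf{D}(S)$ is the set of all $\{s_1,\dots,s_m\}^{\downarrow}$ ($m\ge 1$) with the $s_i$ pairwise compatible, under multiplication of subsets; it is an inverse semigroup whose natural partial order is inclusion. For $S=P_G$ each nonzero $X\in\mathsf{D}(P_G)$ can be written as $X=A_X^{\downarrow}$ for a unique finite set $A_X$ of pairwise orthogonal nonzero elements. For finite subsets of $P_G$ write $\{a_1,\dots,a_m\}\to\{b_1,\dots,b_n\}$ if for every $i$ and every nonzero $x\le a_i$ there is $j$ with $x\wedge b_j\ne 0$, and write $A\leftrightarrow B$ if $A\to B$ and $B\to A$. Define $X\equiv Y$ for nonzero $X,Y\in\mathsf{D}(P_G)$ iff $A_X\leftrightarrow A_Y$, and put $\{0\}\equiv\{0\}$ (the zero being related only to itself). Then $\equiv$ is a congruence, and $[X]$ denotes the $\equiv$-class of $X$.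
   Formalization: The relation at a maximal idempotent e = 1_v1_v^{-1} is claimed in (1), and assumed of θ in (2), only for v of in-degree at least 1; at in-degree 0 one has ê={0}, and ξ(e)=ξ(0) is false. *)

theory Defs
  imports "Graph_Theory.Digraph" "HOL-Library.FuncSet"
begin

section \<open>Inverse semigroups with zero\<close>

record 'a semigrp =
  elts :: "'a set"
  times :: "'a \<Rightarrow> 'a \<Rightarrow> 'a"  (infixl \<open>\<odot>\<index>\<close> 70)

definition is_inverse :: "('a, 'm) semigrp_scheme \<Rightarrow> 'a \<Rightarrow> 'a \<Rightarrow> bool" where
  "is_inverse S a b \<longleftrightarrow> b \<in> elts S \<and> a \<odot>\<^bsub>S\<^esub> b \<odot>\<^bsub>S\<^esub> a = a \<and> b \<odot>\<^bsub>S\<^esub> a \<odot>\<^bsub>S\<^esub> b = b"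

definition is_zero :: "('a, 'm) semigrp_scheme \<Rightarrow> 'a \<Rightarrow> bool" where
  "is_zero S z \<longleftrightarrow> z \<in> elts S \<and> (\<forall>a\<in>elts S. z \<odot>\<^bsub>S\<^esub> a = z \<and> a \<odot>\<^bsub>S\<^esub> z = z)"

text \<open>As throughout, inverse semigroups are required to have a zero.\<close>

locale inverse_semigroup =
  fixes S :: "('a, 'm) semigrp_scheme" (structure)
  assumes times_closed: "\<lbrakk>a \<in> elts S; b \<in> elts S\<rbrakk> \<Longrightarrow> a \<odot> b \<in> elts S"
    and times_assoc: "\<lbrakk>a \<in> elts S; b \<in> elts S; c \<in> elts S\<rbrakk> \<Longrightarrow> (a \<odot> b) \<odot> c = a \<odot> (b \<odot> c)"
    and inverse_ex1: "a \<in> elts S \<Longrightarrow> \<exists>!b. is_inverse S a b"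
    and zero_ex: "\<exists>z. is_zero S z"

definition sinv :: "('a, 'm) semigrp_scheme \<Rightarrow> 'a \<Rightarrow> 'a" where
  "sinv S a = (THE b. is_inverse S a b)"

definition szero :: "('a, 'm) semigrp_scheme \<Rightarrow> 'a" where
  "szero S = (THE z. is_zero S z)"

definition idempotents :: "('a, 'm) semigrp_scheme \<Rightarrow> 'a set" where
  "idempotents S = {e \<in> elts S. e \<odot>\<^bsub>S\<^esub> e = e}"

text \<open>The natural partial order.\<close>

definition nat_le :: "('a, 'm) semigrp_scheme \<Rightarrow> 'a \<Rightarrow> 'a \<Rightarrow> bool" where
  "nat_le S a b \<longleftrightarrow> a \<in> elts S \<and> b \<in> elts S \<and> (\<exists>e\<in>idempotents S. a = b \<odot>\<^bsub>S\<^esub> e)"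

definition nat_less :: "('a, 'm) semigrp_scheme \<Rightarrow> 'a \<Rightarrow> 'a \<Rightarrow> bool" where
  "nat_less S a b \<longleftrightarrow> nat_le S a b \<and> a \<noteq> b"

definition compatible :: "('a, 'm) semigrp_scheme \<Rightarrow> 'a \<Rightarrow> 'a \<Rightarrow> bool" where
  "compatible S s t \<longleftrightarrow>
     sinv S s \<odot>\<^bsub>S\<^esub> t \<in> idempotents S \<and> s \<odot>\<^bsub>S\<^esub> sinv S t \<in> idempotents S"

definition orthogonal :: "('a, 'm) semigrp_scheme \<Rightarrow> 'a \<Rightarrow> 'a \<Rightarrow> bool" where
  "orthogonal S s t \<longleftrightarrow>
     sinv S s \<odot>\<^bsub>S\<^esub> t = szero S \<and> s \<odot>\<^bsub>S\<^esub> sinv S t = szero S"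

definition compatible_set :: "('a, 'm) semigrp_scheme \<Rightarrow> 'a set \<Rightarrow> bool" where
  "compatible_set S A \<longleftrightarrow> A \<subseteq> elts S \<and> (\<forall>s\<in>A. \<forall>t\<in>A. compatible S s t)"

definition is_join :: "('a, 'm) semigrp_scheme \<Rightarrow> 'a set \<Rightarrow> 'a \<Rightarrow> bool" where
  "is_join S A j \<longleftrightarrow> j \<in> elts S \<and> (\<forall>a\<in>A. nat_le S a j) \<and>
     (\<forall>u\<in>elts S. (\<forall>a\<in>A. nat_le S a u) \<longrightarrow> nat_le S j u)"

definition is_meet :: "('a, 'm) semigrp_scheme \<Rightarrow> 'a \<Rightarrow> 'a \<Rightarrow> 'a \<Rightarrow> bool" where
  "is_meet S a b m \<longleftrightarrow> nat_le S m a \<and> nat_le S m b \<and>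
     (\<forall>u\<in>elts S. nat_le S u a \<and> nat_le S u b \<longrightarrow> nat_le S u m)"

definition smeet :: "('a, 'm) semigrp_scheme \<Rightarrow> 'a \<Rightarrow> 'a \<Rightarrow> 'a" where
  "smeet S a b = (THE m. is_meet S a b m)"

definition maximal_idempotents :: "('a, 'm) semigrp_scheme \<Rightarrow> 'a set" where
  "maximal_idempotents S = {e \<in> idempotents S. \<not> (\<exists>f\<in>idempotents S. nat_less S e f)}"

definition covered_by :: "('a, 'm) semigrp_scheme \<Rightarrow> 'a \<Rightarrow> 'a set" where
  "covered_by S e = {f \<in> idempotents S. nat_less S f e \<and>
     \<not> (\<exists>g\<in>idempotents S. nat_less S f g \<and> nat_less S g e)}"

locale distributive_inverse_semigroup = inverse_semigroup +
  assumes join_ex: "\<lbrakk>finite A; A \<noteq> {}; compatible_set S A\<rbrakk> \<Longrightarrow> \<exists>j. is_join S A j"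
    and join_distrib_left: "\<lbrakk>finite A; A \<noteq> {}; A \<subseteq> elts S; is_join S A j; s \<in> elts S\<rbrakk>
          \<Longrightarrow> is_join S ((\<lambda>a. s \<odot> a) ` A) (s \<odot> j)"
    and join_distrib_right: "\<lbrakk>finite A; A \<noteq> {}; A \<subseteq> elts S; is_join S A j; s \<in> elts S\<rbrakk>
          \<Longrightarrow> is_join S ((\<lambda>a. a \<odot> s) ` A) (j \<odot> s)"

definition homomorphism ::
    "('a, 'm) semigrp_scheme \<Rightarrow> ('b, 'n) semigrp_scheme \<Rightarrow> ('a \<Rightarrow> 'b) \<Rightarrow> bool" where
  "homomorphism S T f \<longleftrightarrow> f \<in> elts S \<rightarrow> elts T \<and>
     (\<forall>a\<in>elts S. \<forall>b\<in>elts S. f (a \<odot>\<^bsub>S\<^esub> b) = f a \<odot>\<^bsub>T\<^esub> f b)"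

definition distributive_homomorphism ::
    "('a, 'm) semigrp_scheme \<Rightarrow> ('b, 'n) semigrp_scheme \<Rightarrow> ('a \<Rightarrow> 'b) \<Rightarrow> bool" where
  "distributive_homomorphism S T f \<longleftrightarrow> homomorphism S T f \<and>
     (\<forall>A j. finite A \<and> A \<noteq> {} \<and> compatible_set S A \<and> is_join S A j \<longrightarrow> is_join T (f ` A) (f j))"


section \<open>The graph inverse semigroup\<close>

text \<open>
  In the notation of the literature, \<open>\<^bold>d = tail G\<close> and \<open>\<^bold>r = head G\<close>.  A path is a pair
  consisting of its range and its list of edges \<open>x\<^sub>1, \<dots>, x\<^sub>n\<close>, where
  \<open>\<^bold>d(x\<^sub>i) = \<^bold>r(x\<^sub>i\<^sub>+\<^sub>1)\<close>; the empty path at \<open>v\<close> is \<open>(v, [])\<close>.  (The edges of a path thus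
  come in the order opposite to that of an \<open>awalk\<close>.)
\<close>

type_synonym ('v, 'e) path = "'v \<times> 'e list"

definition paths :: "('v, 'e) pre_digraph \<Rightarrow> ('v, 'e) path set" where
  "paths G = {(v, xs). v \<in> verts G \<and> set xs \<subseteq> arcs G \<and>
     (xs \<noteq> [] \<longrightarrow> head G (hd xs) = v) \<and>
     (\<forall>i. Suc i < length xs \<longrightarrow> tail G (xs ! i) = head G (xs ! Suc i))}"

definition path_ran :: "('v, 'e) path \<Rightarrow> 'v" where
  "path_ran x = fst x"

definition path_dom :: "('v, 'e) pre_digraph \<Rightarrow> ('v, 'e) path \<Rightarrow> 'v" where
  "path_dom G x = (if snd x = [] then fst x else tail G (last (snd x)))"

definition path_cat :: "('v, 'e) path \<Rightarrow> ('v, 'e) path \<Rightarrow> ('v, 'e) path" where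
  "path_cat x y = (fst x, snd x @ snd y)"

definition factors_as ::
    "('v, 'e) pre_digraph \<Rightarrow> ('v, 'e) path \<Rightarrow> ('v, 'e) path \<Rightarrow> ('v, 'e) path \<Rightarrow> bool" where
  "factors_as G u y z \<longleftrightarrow> z \<in> paths G \<and> path_dom G y = path_ran z \<and> u = path_cat y z"

text \<open>\<open>Frac x y\<close> is the formal element \<open>x y\<^sup>-\<^sup>1\<close>.\<close>

datatype ('v, 'e) gis_elt = Zero | Frac "('v, 'e) path" "('v, 'e) path"

fun gis_times ::
    "('v, 'e) pre_digraph \<Rightarrow> ('v, 'e) gis_elt \<Rightarrow> ('v, 'e) gis_elt \<Rightarrow> ('v, 'e) gis_elt" where
  "gis_times G (Frac x y) (Frac u v) =
     (if \<exists>z. factors_as G u y z then Frac (path_cat x (THE z. factors_as G u y z)) v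
      else if \<exists>z. factors_as G y u z then Frac x (path_cat v (THE z. factors_as G y u z))
      else Zero)"
| "gis_times G Zero t = Zero"
| "gis_times G s Zero = Zero"

definition gis :: "('v, 'e) pre_digraph \<Rightarrow> ('v, 'e) gis_elt semigrp" where
  "gis G = \<lparr> elts = insert Zero
       {Frac x y | x y. x \<in> paths G \<and> y \<in> paths G \<and> path_dom G x = path_dom G y},
     times = gis_times G \<rparr>"


section \<open>The Cuntz-Krieger semigroup\<close>

definition down :: "('a, 'm) semigrp_scheme \<Rightarrow> 'a set \<Rightarrow> 'a set" where
  "down S A = {s. \<exists>a\<in>A. nat_le S s a}"

definition DD :: "('a, 'm) semigrp_scheme \<Rightarrow> 'a set semigrp" where
  "DD S = \<lparr> elts = {down S A | A. finite A \<and> A \<noteq> {} \<and> compatible_set S A},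
     times = (\<lambda>X Y. {x \<odot>\<^bsub>S\<^esub> y | x y. x \<in> X \<and> y \<in> Y}) \<rparr>"

text \<open>The finite set \<open>A\<^sub>X\<close> of pairwise orthogonal nonzero elements generating \<open>X \<noteq> {0}\<close>.\<close>

definition orth_gens :: "('a, 'm) semigrp_scheme \<Rightarrow> 'a set \<Rightarrow> 'a set" where
  "orth_gens S X = (THE A. finite A \<and> A \<subseteq> elts S - {szero S} \<and>
     (\<forall>a\<in>A. \<forall>b\<in>A. a \<noteq> b \<longrightarrow> orthogonal S a b) \<and> X = down S A)"

definition arrow :: "('a, 'm) semigrp_scheme \<Rightarrow> 'a set \<Rightarrow> 'a set \<Rightarrow> bool" where
  "arrow S A B \<longleftrightarrow> (\<forall>a\<in>A. \<forall>x\<in>elts S. x \<noteq> szero S \<and> nat_le S x a \<longrightarrow>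
     (\<exists>b\<in>B. smeet S x b \<noteq> szero S))"

definition ck_rel :: "('a, 'm) semigrp_scheme \<Rightarrow> ('a set \<times> 'a set) set" where
  "ck_rel S = {(X, Y). X \<in> elts (DD S) \<and> Y \<in> elts (DD S) \<and>
     (X = {szero S} \<and> Y = {szero S} \<or>
      X \<noteq> {szero S} \<and> Y \<noteq> {szero S} \<and>
        arrow S (orth_gens S X) (orth_gens S Y) \<and> arrow S (orth_gens S Y) (orth_gens S X))}"

text \<open>
  The union in the product is over classes that all coincide, because \<open>ck_rel (gis G)\<close> is a
  congruence.
\<close>

definition CK :: "('v, 'e) pre_digraph \<Rightarrow> ('v, 'e) gis_elt set set semigrp" where
  "CK G = \<lparr> elts = elts (DD (gis G)) // ck_rel (gis G),
     times = (\<lambda>C D. \<Union>X\<in>C. \<Union>Y\<in>D. ck_rel (gis G) `` {X \<odot>\<^bsub>DD (gis G)\<^esub> Y}) \<rparr>"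

definition ck_map :: "('v, 'e) pre_digraph \<Rightarrow> ('v, 'e) gis_elt \<Rightarrow> ('v, 'e) gis_elt set set" where
  "ck_map G s = ck_rel (gis G) `` {down (gis G) {s}}"

text \<open>
  The maximal idempotents at which the Cuntz-Krieger relation \<open>e = \<Squnion>{f. f is covered by e}\<close> is imposed.
  As usual for Cuntz-Krieger relations, vertices of in-degree 0 are exempt: for these,
  \<open>e = 1\<^sub>v1\<^sub>v\<^sup>-\<^sup>1\<close> covers only \<open>0\<close>, and the relation would read \<open>e = 0\<close>, which fails in
  \<open>CK G\<close> since \<open>{0}\<close> is related only to itself.
\<close>

definition ck_idempotents :: "('a, 'm) semigrp_scheme \<Rightarrow> 'a set" where
  "ck_idempotents S = {e \<in> maximal_idempotents S. \<exists>f\<in>covered_by S e. f \<noteq> szero S}"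

end

theory Submission
  imports Defs
begin

text \<open>
  \<open>P\<^sub>G\<close> acts faithfully on paths: \<open>xy\<^sup>-\<^sup>1\<close> becomes the partial bijection of all pairs \<open>(xz, yz)\<close>, and
  an element of \<open>D(P\<^sub>G)\<close> becomes the union of the partial bijections of its members.  Products turn
  into compositions and the natural order into inclusion.  Since elements of \<open>P\<^sub>G\<close> with a nonzero
  common lower bound are comparable, \<open>X \<equiv> Y\<close> says that each pair in the relation of \<open>X\<close> can be
  extended by a path to a pair in the relation of \<open>Y\<close> and conversely; the one-sided version of this
  condition is the natural order of \<open>CK\<^sub>G\<close>.  Hence the join of a compatible family of classes is
  the class of the union.

  For the universal property, \<open>[X]\<close> is sent to the join of \<open>\<theta>(X)\<close>.  This respects \<open>\<equiv>\<close> because the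
  Cuntz-Krieger relations express \<open>\<theta>(xy\<^sup>-\<^sup>1)\<close> as a join of values \<open>\<theta>(xz(yz)\<^sup>-\<^sup>1)\<close> with \<open>z\<close> so long that
  a nonzero lower bound in \<open>Y\<close> already forces \<open>xz(yz)\<^sup>-\<^sup>1\<close> itself into \<open>Y\<close>.
\<close>

section \<open>Inverse semigroups\<close>

text \<open>The arrow is defined through the orthogonal generators, which products and unions of
  ideals do not respect. The congruence is therefore rewritten as a condition on the relation of X
  alone (\<open>dense_below\<close>), and generators return only where finiteness is needed. The
  congruence is idempotent-pure: a class is idempotent only if its representatives are, because a
  pair with a diagonal common extension is itself diagonal. So compatibility and commutation of
  idempotents can be tested on representatives, although a class has no single relation of its own.
  Distributivity is demanded for every finite nonempty set that has a join. In \<open>CK G\<close>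
  such a set is bounded, and boundedness already forces compatibility. The obstacle to the universal
  property is that the relations hold at vertices only and say nothing at in-degree 0. Finite
  in-degree makes the joins ones that distribute, finite generation bounds the depth of the
  expansion, and at a vertex without incoming edges density is plain membership.\<close>

lemma inverse_semigroupI:
  fixes S :: "('a, 'm) semigrp_scheme" (structure)
  assumes closed: "\<And>a b. \<lbrakk>a \<in> elts S; b \<in> elts S\<rbrakk> \<Longrightarrow> a \<odot> b \<in> elts S"
    and assoc: "\<And>a b c. \<lbrakk>a \<in> elts S; b \<in> elts S; c \<in> elts S\<rbrakk> \<Longrightarrow> (a \<odot> b) \<odot> c = a \<odot> (b \<odot> c)"
    and inverse: "\<And>a. a \<in> elts S \<Longrightarrow> \<exists>b. is_inverse S a b"
    and commute: "\<And>e f. \<lbrakk>e \<in> idempotents S; f \<in> idempotents S\<rbrakk> \<Longrightarrow> e \<odot> f = f \<odot> e"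
    and zero: "\<exists>z. is_zero S z"
  shows "inverse_semigroup S"
proof
  fix a assume a: "a \<in> elts S"
  show "\<exists>!b. is_inverse S a b"
  proof (rule ex_ex1I[OF inverse[OF a]])
    fix b c assume "is_inverse S a b" "is_inverse S a c"
    then have b: "b \<in> elts S" "a \<odot> b \<odot> a = a" "b \<odot> a \<odot> b = b"
      and c: "c \<in> elts S" "a \<odot> c \<odot> a = a" "c \<odot> a \<odot> c = c"
      by (auto simp: is_inverse_def)
    note cl = closed a b(1) c(1)
    have idem: "b \<odot> a \<in> idempotents S" "c \<odot> a \<in> idempotents S"
      "a \<odot> b \<in> idempotents S" "a \<odot> c \<in> idempotents S"
      using b c by (simp_all add: idempotents_def cl assoc[symmetric])
    \<comment> \<open>Both inverses are shown to equal cab: commuting ba with ca rewrites b, and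
      commuting ab with ac rewrites c.\<close>
    have "b = b \<odot> (a \<odot> c \<odot> a) \<odot> b" using b c by simp
    also have "\<dots> = (b \<odot> a) \<odot> (c \<odot> a) \<odot> b" by (simp add: assoc cl)
    also have "\<dots> = (c \<odot> a) \<odot> (b \<odot> a) \<odot> b" using idem commute by simp
    also have "\<dots> = c \<odot> (a \<odot> b \<odot> a) \<odot> b" by (simp add: assoc cl)
    also have "\<dots> = c \<odot> a \<odot> b" using b by simp
    finally have 1: "b = c \<odot> a \<odot> b" .
    have "c = c \<odot> (a \<odot> b \<odot> a) \<odot> c" using b c by simp
    also have "\<dots> = c \<odot> ((a \<odot> b) \<odot> (a \<odot> c))" by (simp add: assoc cl)
    also have "\<dots> = c \<odot> ((a \<odot> c) \<odot> (a \<odot> b))" using idem commute by simp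
    also have "\<dots> = (c \<odot> a \<odot> c) \<odot> a \<odot> b" by (simp add: assoc cl)
    also have "\<dots> = c \<odot> a \<odot> b" using c by simp
    finally show "b = c" using 1 by metis
  qed
qed (use closed assoc zero in auto)

lemma homomorphism_closed:
  "\<lbrakk>homomorphism S T f; a \<in> elts S\<rbrakk> \<Longrightarrow> f a \<in> elts T"
  by (auto simp: homomorphism_def)

lemma homomorphism_times:
  "\<lbrakk>homomorphism S T f; a \<in> elts S; b \<in> elts S\<rbrakk> \<Longrightarrow> f (a \<odot>\<^bsub>S\<^esub> b) = f a \<odot>\<^bsub>T\<^esub> f b"
  by (auto simp: homomorphism_def)

lemma homomorphism_idempotents:
  "\<lbrakk>homomorphism S T f; e \<in> idempotents S\<rbrakk> \<Longrightarrow> f e \<in> idempotents T"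
  unfolding idempotents_def
  by (auto simp: homomorphism_closed) (metis homomorphism_times)

lemma homomorphism_nat_le:
  assumes "homomorphism S T f" "nat_le S a b"
  shows "nat_le T (f a) (f b)"
proof -
  obtain e where e: "a \<in> elts S" "b \<in> elts S" "e \<in> idempotents S" "a = b \<odot>\<^bsub>S\<^esub> e"
    using assms(2) by (auto simp: nat_le_def)
  moreover have "e \<in> elts S" using e by (simp add: idempotents_def)
  ultimately show ?thesis
    using assms(1) homomorphism_times[OF assms(1) \<open>b \<in> elts S\<close> \<open>e \<in> elts S\<close>]
    unfolding nat_le_def by (metis homomorphism_closed homomorphism_idempotents)
qed

section \<open>Inverses, idempotents, the natural order and joins\<close>

context inverse_semigroup
begin

lemma is_inverse_sinv: "a \<in> elts S \<Longrightarrow> is_inverse S a (sinv S a)"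
  unfolding sinv_def by (rule theI'[OF inverse_ex1])

lemma sinv_eqI: "\<lbrakk>a \<in> elts S; is_inverse S a b\<rbrakk> \<Longrightarrow> sinv S a = b"
  using is_inverse_sinv inverse_ex1 by blast

lemma sinv_closed: "a \<in> elts S \<Longrightarrow> sinv S a \<in> elts S"
  using is_inverse_sinv by (auto simp: is_inverse_def)

lemma idempotents_closed: "e \<in> idempotents S \<Longrightarrow> e \<in> elts S"
  by (simp add: idempotents_def)

text \<open>Let x be the inverse of ef. Then fxe is another inverse of ef, so x = fxe, and this form
  makes x idempotent. An idempotent is its own inverse, while ef is also an inverse of x; hence ef =
  x.\<close>

lemma idempotents_times:
  assumes "e \<in> idempotents S" "f \<in> idempotents S"
  shows "e \<odot> f \<in> idempotents S"
proof -
  have e: "e \<in> elts S" "e \<odot> e = e" and f: "f \<in> elts S" "f \<odot> f = f"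
    using assms by (auto simp: idempotents_def)
  define x where "x = sinv S (e \<odot> f)"
  have ef: "e \<odot> f \<in> elts S" using e f times_closed by blast
  have x: "x \<in> elts S" and x1: "(e \<odot> f) \<odot> x \<odot> (e \<odot> f) = e \<odot> f" and x2: "x \<odot> (e \<odot> f) \<odot> x = x"
    using is_inverse_sinv[OF ef] by (auto simp: is_inverse_def x_def)
  note cl = times_closed e(1) f(1) x
  note as = times_assoc cl
  have e': "e \<odot> (e \<odot> y) = e \<odot> y" if "y \<in> elts S" for y
    using e that by (simp add: times_assoc[symmetric])
  have f': "f \<odot> (f \<odot> y) = f \<odot> y" if "y \<in> elts S" for y
    using f that by (simp add: times_assoc[symmetric])
  have x1': "e \<odot> (f \<odot> (x \<odot> (e \<odot> f))) = e \<odot> f" using x1 by (simp add: as)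
  have x2': "x \<odot> (e \<odot> (f \<odot> x)) = x" using x2 by (simp add: as)
  have x2'': "x \<odot> (e \<odot> (f \<odot> (x \<odot> y))) = x \<odot> y" if "y \<in> elts S" for y
    using arg_cong[OF x2', of "\<lambda>u. u \<odot> y"] that by (simp add: as)
  have "is_inverse S (e \<odot> f) (f \<odot> x \<odot> e)"
    using x1' by (simp add: is_inverse_def as e' f' x2'')
  then have fxe: "x = f \<odot> x \<odot> e" using sinv_eqI[OF ef] x_def by metis
  then have "x \<odot> x = (f \<odot> x \<odot> e) \<odot> (f \<odot> x \<odot> e)" by metis
  also have "\<dots> = f \<odot> x \<odot> e" by (simp add: as x2'')
  finally have xx: "x \<odot> x = x" using fxe by metis
  have "is_inverse S x x" by (simp add: is_inverse_def xx x)
  moreover have "is_inverse S x (e \<odot> f)" using x1 x2 ef by (simp add: is_inverse_def)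
  ultimately have "x = e \<odot> f" using sinv_eqI[OF x] by metis
  then show ?thesis using xx x by (simp add: idempotents_def)
qed

text \<open>Since ef and fe are idempotent, both are inverses of ef, and inverses are
  unique.\<close>

lemma idempotents_commute:
  assumes "e \<in> idempotents S" "f \<in> idempotents S"
  shows "e \<odot> f = f \<odot> e"
proof -
  have e: "e \<in> elts S" "e \<odot> e = e" and f: "f \<in> elts S" "f \<odot> f = f"
    using assms by (auto simp: idempotents_def)
  note as = times_assoc times_closed e(1) f(1)
  have e': "e \<odot> (e \<odot> y) = e \<odot> y" if "y \<in> elts S" for y
    using e that by (simp add: times_assoc[symmetric])
  have f': "f \<odot> (f \<odot> y) = f \<odot> y" if "y \<in> elts S" for y
    using f that by (simp add: times_assoc[symmetric])
  have ef: "(e \<odot> f) \<odot> (e \<odot> f) = e \<odot> f" and fe: "(f \<odot> e) \<odot> (f \<odot> e) = f \<odot> e"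
    using idempotents_times assms by (auto simp: idempotents_def)
  have "is_inverse S (e \<odot> f) (f \<odot> e)"
    using ef fe by (simp add: is_inverse_def as e' f')
  moreover have "is_inverse S (e \<odot> f) (e \<odot> f)"
    using ef by (simp add: is_inverse_def as)
  ultimately show ?thesis using sinv_eqI[of "e \<odot> f"] times_closed e f by metis
qed

lemma nat_le_refl:
  assumes a: "a \<in> elts S"
  shows "nat_le S a a"
proof -
  have b: "sinv S a \<in> elts S" "a \<odot> sinv S a \<odot> a = a"
    using is_inverse_sinv[OF a] by (simp_all add: is_inverse_def)
  then have "a = a \<odot> (sinv S a \<odot> a)" using a by (simp add: times_assoc)
  moreover have "(sinv S a \<odot> a) \<odot> (sinv S a \<odot> a) = sinv S a \<odot> (a \<odot> sinv S a \<odot> a)"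
    using a b by (simp add: times_assoc times_closed)
  then have "sinv S a \<odot> a \<in> idempotents S"
    using a b by (simp add: idempotents_def times_closed)
  ultimately show ?thesis using a unfolding nat_le_def by blast
qed

lemma nat_le_antisym: "\<lbrakk>nat_le S a b; nat_le S b a\<rbrakk> \<Longrightarrow> a = b"
proof -
  assume "nat_le S a b" "nat_le S b a"
  then obtain e f where a: "a \<in> elts S" and b: "b \<in> elts S" and e: "e \<in> idempotents S"
    and f: "f \<in> idempotents S" and ab: "a = b \<odot> e" and ba: "b = a \<odot> f"
    unfolding nat_le_def by blast
  have ee: "e \<in> elts S" "f \<in> elts S" "e \<odot> e = e" "f \<odot> f = f" using e f by (auto simp: idempotents_def)
  have "a \<odot> e = a" using ab b ee by (simp add: times_assoc)
  have "b = a \<odot> (e \<odot> f)" using \<open>a \<odot> e = a\<close> ba a ee by (simp add: times_assoc[symmetric])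
  also have "\<dots> = a \<odot> (f \<odot> e)" using idempotents_commute[OF e f] by simp
  also have "\<dots> = b \<odot> e" using ba a ee by (simp add: times_assoc[symmetric])
  finally show "a = b" using ab by metis
qed

lemma nat_le_trans: "\<lbrakk>nat_le S a b; nat_le S b c\<rbrakk> \<Longrightarrow> nat_le S a c"
proof -
  assume "nat_le S a b" "nat_le S b c"
  then obtain e f where *: "a \<in> elts S" "c \<in> elts S" "e \<in> idempotents S"
    "f \<in> idempotents S" "a = (c \<odot> f) \<odot> e"
    by (auto simp: nat_le_def)
  then have "a = c \<odot> (f \<odot> e)" by (simp add: times_assoc idempotents_closed)
  then show "nat_le S a c" using * idempotents_times by (auto simp: nat_le_def)
qed

lemma is_join_unique: "\<lbrakk>is_join S A j; is_join S A k\<rbrakk> \<Longrightarrow> j = k"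
  unfolding is_join_def by (blast intro: nat_le_antisym)

lemma szero_eqI: "is_zero S z \<Longrightarrow> szero S = z"
  unfolding szero_def by (rule the_equality) (auto simp: is_zero_def)

lemma homomorphism_sinv:
  assumes f: "homomorphism S' S f" and S': "inverse_semigroup S'" and a: "a \<in> elts S'"
  shows "f (sinv S' a) = sinv S (f a)"
proof -
  interpret S': inverse_semigroup S' by fact
  have i: "is_inverse S' a (sinv S' a)" using S'.is_inverse_sinv a .
  then have c: "sinv S' a \<in> elts S'" by (simp add: is_inverse_def)
  have "is_inverse S (f a) (f (sinv S' a))"
    using i a c homomorphism_closed[OF f] homomorphism_times[OF f] S'.times_closed
    unfolding is_inverse_def by metis
  then show ?thesis using sinv_eqI homomorphism_closed[OF f a] by simp
qed

lemma homomorphism_compatible_set: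
  assumes f: "homomorphism S' S f" and S': "inverse_semigroup S'" and A: "compatible_set S' A"
  shows "compatible_set S (f ` A)"
proof -
  interpret S': inverse_semigroup S' by fact
  show ?thesis unfolding compatible_set_def compatible_def
  proof (safe)
    show "f a \<in> elts S" if "a \<in> A" for a
      using that A homomorphism_closed[OF f] by (auto simp: compatible_set_def)
    fix s t assume "s \<in> A" "t \<in> A"
    then have s: "s \<in> elts S'" and t: "t \<in> elts S'"
      and *: "sinv S' s \<odot>\<^bsub>S'\<^esub> t \<in> idempotents S'" "s \<odot>\<^bsub>S'\<^esub> sinv S' t \<in> idempotents S'"
      using A by (auto simp: compatible_set_def compatible_def)
    show "sinv S (f s) \<odot> f t \<in> idempotents S" "f s \<odot> sinv S (f t) \<in> idempotents S"
      using *[THEN homomorphism_idempotents[OF f]] s t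
      by (simp_all add: homomorphism_times[OF f] S'.sinv_closed homomorphism_sinv[OF f S'])
  qed
qed

text \<open>A join depends on a set only through its upper bounds. This permits exchanging a finite
  generating set for the possibly infinite ideal that it generates.\<close>

lemma is_join_cong:
  assumes "\<And>u. u \<in> elts S \<Longrightarrow> (\<forall>a\<in>A. nat_le S a u) \<longleftrightarrow> (\<forall>b\<in>B. nat_le S b u)"
  shows "is_join S A j \<longleftrightarrow> is_join S B j"
  using assms unfolding is_join_def by blast

lemma is_join_le_iff:
  "\<lbrakk>is_join S A j; u \<in> elts S\<rbrakk> \<Longrightarrow> nat_le S j u \<longleftrightarrow> (\<forall>a\<in>A. nat_le S a u)"
  unfolding is_join_def using nat_le_trans by blast

lemma is_join_singleton: "a \<in> elts S \<Longrightarrow> is_join S {a} a"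
  by (simp add: is_join_def nat_le_refl)

lemma is_join_Union:
  assumes "\<And>i. i \<in> I \<Longrightarrow> is_join S (F i) (g i)" and "is_join S (g ` I) j"
  shows "is_join S (\<Union>i\<in>I. F i) j"
  unfolding is_join_def
proof (intro conjI ballI impI)
  show "j \<in> elts S" using assms(2) by (simp add: is_join_def)
  show "nat_le S a j" if "a \<in> (\<Union>i\<in>I. F i)" for a
  proof -
    from that obtain i where i: "i \<in> I" "a \<in> F i" by blast
    then have "nat_le S a (g i)" "nat_le S (g i) j"
      using assms by (auto simp: is_join_def)
    then show ?thesis by (rule nat_le_trans)
  qed
  fix u assume "u \<in> elts S" and "\<forall>a\<in>\<Union>i\<in>I. F i. nat_le S a u"
  then show "nat_le S j u" using assms by (simp add: is_join_def)
qed

end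

text \<open>Left distributivity presents each ak as the join of the ab, right distributivity
  presents jk as the join of the ak, and the two levels are merged by
  \<open>is_join_Union\<close>.\<close>

lemma distributive_join_times:
  fixes T :: "('a, 'm) semigrp_scheme" (structure)
  assumes T: "distributive_inverse_semigroup T"
    and A: "finite A" "A \<noteq> {}" "A \<subseteq> elts T" "is_join T A j"
    and B: "finite B" "B \<noteq> {}" "B \<subseteq> elts T" "is_join T B k"
  shows "is_join T (\<Union>a\<in>A. (\<lambda>b. a \<odot> b) ` B) (j \<odot> k)"
proof -
  interpret distributive_inverse_semigroup T by fact
  show ?thesis
  proof (rule is_join_Union)
    show "is_join T ((\<lambda>b. a \<odot> b) ` B) (a \<odot> k)" if "a \<in> A" for a
      using that join_distrib_left[OF B] A by blast
    show "is_join T ((\<lambda>a. a \<odot> k) ` A) (j \<odot> k)"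
      using join_distrib_right[OF A] B by (auto simp: is_join_def)
  qed
qed


section \<open>Semigroups of partial bijections\<close>

definition partial_bij :: "('p \<times> 'p) set \<Rightarrow> bool" where
  "partial_bij R \<longleftrightarrow> single_valued R \<and> single_valued (R\<inverse>)"

lemma partial_bijD1: "\<lbrakk>partial_bij R; (a, b) \<in> R; (a, c) \<in> R\<rbrakk> \<Longrightarrow> b = c"
  by (auto simp: partial_bij_def single_valued_def)

lemma partial_bijD2: "\<lbrakk>partial_bij R; (a, c) \<in> R; (b, c) \<in> R\<rbrakk> \<Longrightarrow> a = b"
  by (auto simp: partial_bij_def single_valued_def)

lemma partial_bijI:
  assumes "\<And>a b c. \<lbrakk>(a, b) \<in> R; (a, c) \<in> R\<rbrakk> \<Longrightarrow> b = c"
    and "\<And>a b c. \<lbrakk>(a, c) \<in> R; (b, c) \<in> R\<rbrakk> \<Longrightarrow> a = b"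
  shows "partial_bij R"
  using assms unfolding partial_bij_def single_valued_def by blast

lemma partial_bij_relcomp: "\<lbrakk>partial_bij R; partial_bij Q\<rbrakk> \<Longrightarrow> partial_bij (R O Q)"
  by (auto intro!: partial_bijI dest: partial_bijD1 partial_bijD2)

text \<open>A faithful representation in the style of Wagner and Preston, taken as a hypothesis:
  associativity, commuting idempotents and the order then become facts about relations. It is
  instantiated for both \<open>gis G\<close> and \<open>DD (gis G)\<close>.\<close>

locale partial_bij_rep =
  fixes S :: "('a, 'm) semigrp_scheme" (structure) and \<rho> :: "'a \<Rightarrow> ('p \<times> 'p) set"
  assumes rep_closed: "\<lbrakk>a \<in> elts S; b \<in> elts S\<rbrakk> \<Longrightarrow> a \<odot> b \<in> elts S"
    and rep_times: "\<lbrakk>a \<in> elts S; b \<in> elts S\<rbrakk> \<Longrightarrow> \<rho> (a \<odot> b) = \<rho> a O \<rho> b"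
    and rep_inj: "inj_on \<rho> (elts S)"
    and rep_partial_bij: "a \<in> elts S \<Longrightarrow> partial_bij (\<rho> a)"
    and rep_converse: "a \<in> elts S \<Longrightarrow> \<exists>b\<in>elts S. \<rho> b = (\<rho> a)\<inverse>"
    and rep_empty: "\<exists>z\<in>elts S. \<rho> z = {}"
begin

lemma rep_eq_iff: "\<lbrakk>a \<in> elts S; b \<in> elts S\<rbrakk> \<Longrightarrow> a = b \<longleftrightarrow> \<rho> a = \<rho> b"
  using rep_inj by (auto dest: inj_onD)

text \<open>If a pair (x, y) of an idempotent factors through z, single-valuedness in the two
  directions gives z = y and z = x.\<close>

lemma idempotents_iff: "a \<in> idempotents S \<longleftrightarrow> a \<in> elts S \<and> \<rho> a \<subseteq> Id"
proof
  assume "a \<in> idempotents S"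
  then have a: "a \<in> elts S" "\<rho> a O \<rho> a = \<rho> a"
    using rep_times by (fastforce simp: idempotents_def)+
  have "x = y" if "(x, y) \<in> \<rho> a" for x y
  proof -
    from that a(2) obtain z where "(x, z) \<in> \<rho> a" "(z, y) \<in> \<rho> a" by blast
    then show ?thesis using that partial_bijD1 partial_bijD2 rep_partial_bij[OF a(1)] by metis
  qed
  then show "a \<in> elts S \<and> \<rho> a \<subseteq> Id" using a by auto
next
  assume a: "a \<in> elts S \<and> \<rho> a \<subseteq> Id"
  then have "\<rho> a O \<rho> a = \<rho> a" by blast
  then show "a \<in> idempotents S"
    using a rep_eq_iff[of "a \<odot> a" a] rep_closed rep_times by (simp add: idempotents_def)
qed

lemma is_inverse_rep:
  assumes "a \<in> elts S" "b \<in> elts S" "\<rho> b = (\<rho> a)\<inverse>"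
  shows "is_inverse S a b"
proof -
  have "\<rho> a O (\<rho> a)\<inverse> O \<rho> a = \<rho> a" "(\<rho> a)\<inverse> O \<rho> a O (\<rho> a)\<inverse> = (\<rho> a)\<inverse>"
    using rep_partial_bij[OF assms(1)] by (auto dest: partial_bijD1 partial_bijD2)
  then show ?thesis
    using assms by (auto simp: is_inverse_def rep_eq_iff rep_closed rep_times O_assoc)
qed

lemma is_zero_rep: "\<lbrakk>z \<in> elts S; \<rho> z = {}\<rbrakk> \<Longrightarrow> is_zero S z"
  by (auto simp: is_zero_def rep_eq_iff rep_closed rep_times)

sublocale inverse_semigroup S
proof (rule inverse_semigroupI)
  show "e \<odot> f = f \<odot> e" if "e \<in> idempotents S" "f \<in> idempotents S" for e f
    using that unfolding idempotents_iff by (auto simp: rep_eq_iff rep_closed rep_times)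
  show "\<exists>z. is_zero S z" using rep_empty is_zero_rep by blast
  show "\<exists>b. is_inverse S a b" if "a \<in> elts S" for a
    using that rep_converse is_inverse_rep by blast
qed (auto simp: rep_eq_iff rep_closed rep_times O_assoc)

lemma rep_sinv: "a \<in> elts S \<Longrightarrow> \<rho> (sinv S a) = (\<rho> a)\<inverse>"
  using rep_converse is_inverse_rep sinv_eqI by metis

lemma rep_szero: "\<rho> (szero S) = {}" and szero_closed: "szero S \<in> elts S"
  using rep_empty is_zero_rep szero_eqI by metis+

lemma nat_le_iff: "nat_le S a b \<longleftrightarrow> a \<in> elts S \<and> b \<in> elts S \<and> \<rho> a \<subseteq> \<rho> b"
proof
  assume "nat_le S a b"
  then obtain e where "a \<in> elts S" "b \<in> elts S" and e: "e \<in> idempotents S" and ab: "a = b \<odot> e"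
    unfolding nat_le_def by blast
  moreover have "e \<in> elts S" "\<rho> e \<subseteq> Id" using e by (simp_all add: idempotents_iff)
  moreover have "\<rho> a = \<rho> b O \<rho> e"
    unfolding ab using \<open>b \<in> elts S\<close> \<open>e \<in> elts S\<close> by (rule rep_times)
  moreover have "\<rho> b O \<rho> e \<subseteq> \<rho> b" using \<open>\<rho> e \<subseteq> Id\<close> by blast
  ultimately show "a \<in> elts S \<and> b \<in> elts S \<and> \<rho> a \<subseteq> \<rho> b" by simp
next
  assume *: "a \<in> elts S \<and> b \<in> elts S \<and> \<rho> a \<subseteq> \<rho> b"
  \<comment> \<open>The relation of this idempotent is the identity on the second components of
    \<open>\<rho> a\<close>. It cuts b down to a exactly: a pair of b ending in such a component
    must be the pair of a, by injectivity of b.\<close>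
  define e where "e = sinv S a \<odot> a"
  have e: "e \<in> elts S" "\<rho> e = (\<rho> a)\<inverse> O \<rho> a"
    unfolding e_def using * by (simp_all add: rep_closed rep_times rep_sinv sinv_closed)
  have pb: "partial_bij (\<rho> a)" "partial_bij (\<rho> b)" using * rep_partial_bij by auto
  have "(\<rho> a)\<inverse> O \<rho> a \<subseteq> Id" using partial_bijD1[OF pb(1)] by blast
  then have "e \<in> idempotents S" unfolding idempotents_iff using e by simp
  moreover have "\<rho> a = \<rho> b O (\<rho> a)\<inverse> O \<rho> a"
  proof (intro equalityI subrelI)
    fix x y assume "(x, y) \<in> \<rho> b O (\<rho> a)\<inverse> O \<rho> a"
    then obtain z w where "(x, z) \<in> \<rho> b" "(w, z) \<in> \<rho> a" "(w, y) \<in> \<rho> a" by blast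
    then show "(x, y) \<in> \<rho> a" using pb * by (metis partial_bijD1 partial_bijD2 subsetD)
  qed (use * in blast)
  then have "a = b \<odot> e" using * e by (simp add: rep_eq_iff rep_closed rep_times)
  ultimately show "nat_le S a b" using * by (auto simp: nat_le_def)
qed

lemma compatible_iff:
  assumes "s \<in> elts S" "t \<in> elts S"
  shows "compatible S s t \<longleftrightarrow> (\<rho> s)\<inverse> O \<rho> t \<subseteq> Id \<and> \<rho> s O (\<rho> t)\<inverse> \<subseteq> Id"
  using assms by (simp add: compatible_def idempotents_iff rep_closed rep_times rep_sinv sinv_closed)

text \<open>The two idempotents in the definition of compatibility say that s and t agree wherever
  they share a first or a second component. A compatible set is thus one whose relations glue to a
  partial bijection, which is why an ideal can be represented by a union.\<close>

lemma compatible_set_iff: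
  "compatible_set S A \<longleftrightarrow> A \<subseteq> elts S \<and> partial_bij (\<Union>(\<rho> ` A))"
proof
  assume A: "compatible_set S A"
  then have sub: "A \<subseteq> elts S" by (simp add: compatible_set_def)
  have *: "(\<rho> s)\<inverse> O \<rho> t \<subseteq> Id" "\<rho> s O (\<rho> t)\<inverse> \<subseteq> Id" if "s \<in> A" "t \<in> A" for s t
    using that A sub compatible_iff[of s t] unfolding compatible_set_def by blast+
  have "partial_bij (\<Union>(\<rho> ` A))"
  proof (rule partial_bijI)
    fix a b c assume "(a, b) \<in> \<Union>(\<rho> ` A)" "(a, c) \<in> \<Union>(\<rho> ` A)"
    then obtain s t where "s \<in> A" "t \<in> A" "(a, b) \<in> \<rho> s" "(a, c) \<in> \<rho> t" by blast
    then show "b = c" using *(1)[of s t] by blast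
  next
    fix a b c assume "(a, c) \<in> \<Union>(\<rho> ` A)" "(b, c) \<in> \<Union>(\<rho> ` A)"
    then obtain s t where "s \<in> A" "t \<in> A" "(a, c) \<in> \<rho> s" "(b, c) \<in> \<rho> t" by blast
    then show "a = b" using *(2)[of s t] by blast
  qed
  then show "A \<subseteq> elts S \<and> partial_bij (\<Union>(\<rho> ` A))" using sub by simp
next
  assume *: "A \<subseteq> elts S \<and> partial_bij (\<Union>(\<rho> ` A))"
  have "compatible S s t" if st: "s \<in> A" "t \<in> A" for s t
  proof -
    have el: "s \<in> elts S" "t \<in> elts S" using that * by auto
    have "(\<rho> s)\<inverse> O \<rho> t \<subseteq> Id"
    proof (rule subrelI)
      fix b c assume "(b, c) \<in> (\<rho> s)\<inverse> O \<rho> t"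
      then obtain a where "(a, b) \<in> \<rho> s" "(a, c) \<in> \<rho> t" by blast
      then show "(b, c) \<in> Id" using st partial_bijD1[OF conjunct2[OF *], of a b c] by blast
    qed
    moreover have "\<rho> s O (\<rho> t)\<inverse> \<subseteq> Id"
    proof (rule subrelI)
      fix a b assume "(a, b) \<in> \<rho> s O (\<rho> t)\<inverse>"
      then obtain c where "(a, c) \<in> \<rho> s" "(b, c) \<in> \<rho> t" by blast
      then show "(a, b) \<in> Id" using st partial_bijD2[OF conjunct2[OF *], of a c b] by blast
    qed
    ultimately show ?thesis using el by (simp add: compatible_iff)
  qed
  then show "compatible_set S A" using * by (auto simp: compatible_set_def)
qed

lemma orthogonal_iff:
  assumes "s \<in> elts S" "t \<in> elts S"
  shows "orthogonal S s t \<longleftrightarrow> (\<rho> s)\<inverse> O \<rho> t = {} \<and> \<rho> s O (\<rho> t)\<inverse> = {}"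
  using assms by (simp add: orthogonal_def rep_eq_iff szero_closed rep_szero rep_closed rep_times rep_sinv sinv_closed)

lemma eq_szero_iff: "a \<in> elts S \<Longrightarrow> a = szero S \<longleftrightarrow> \<rho> a = {}"
  by (simp add: rep_eq_iff szero_closed rep_szero)

end


section \<open>The graph inverse semigroup\<close>

lemma paths_Nil [simp]: "(v, []) \<in> paths G \<longleftrightarrow> v \<in> verts G"
  by (simp add: paths_def)

lemma path_dom_Nil [simp]: "path_dom G (v, []) = v"
  by (simp add: path_dom_def)

lemma path_dom_Cons [simp]: "path_dom G (v, e # es) = path_dom G (tail G e, es)"
  by (simp add: path_dom_def)

text \<open>The appended part is a bare list of edges rather than a path, so that iterated extension
  is list append and cancellation carries no side conditions. Whether the result is a path is
  tracked separately.\<close>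

definition ext :: "('v, 'e) path \<Rightarrow> 'e list \<Rightarrow> ('v, 'e) path" where
  "ext a zs = (fst a, snd a @ zs)"

lemma ext_Nil [simp]: "ext a [] = a"
  by (simp add: ext_def)

lemma ext_ext [simp]: "ext (ext a p) q = ext a (p @ q)"
  by (simp add: ext_def)

lemma ext_cancel_left [simp]: "ext a p = ext a q \<longleftrightarrow> p = q"
  by (simp add: ext_def)

lemma ext_cancel_right [simp]: "ext a p = ext b p \<longleftrightarrow> a = b"
  by (auto simp: ext_def prod_eq_iff)

lemma ext_eq_self [simp]: "ext a p = a \<longleftrightarrow> p = []" "a = ext a p \<longleftrightarrow> p = []"
  by (auto simp: ext_def prod_eq_iff)

text \<open>Two prefixes of one word are comparable. Both the three cases of the product and the
  forest-like order on nonzero elements come from this.\<close>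

lemma ext_eq_ext:
  assumes "ext a p = ext b q"
  obtains (left) z where "b = ext a z" "p = z @ q" | (right) z where "a = ext b z" "q = z @ p"
proof -
  have f: "fst a = fst b" and "snd a @ p = snd b @ q" using assms by (simp_all add: ext_def)
  then obtain us where "snd a = snd b @ us \<and> us @ p = q \<or> snd a @ us = snd b \<and> p = us @ q"
    by (auto simp: append_eq_append_conv2)
  then show thesis
    using f left[of us] right[of us] by (metis ext_def prod.collapse)
qed

definition path_pairs :: "('v, 'e) pre_digraph \<Rightarrow> (('v, 'e) path \<times> ('v, 'e) path) set" where
  "path_pairs G = {(a, b). a \<in> paths G \<and> b \<in> paths G \<and> path_dom G a = path_dom G b}"

text \<open>
  A pair \<open>(a, b)\<close> in this relation corresponds to a nonzero element \<open>Frac a b\<close> below the given one.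
\<close>

fun gis_rel :: "('v, 'e) pre_digraph \<Rightarrow> ('v, 'e) gis_elt \<Rightarrow> (('v, 'e) path \<times> ('v, 'e) path) set" where
  "gis_rel G (Frac x y) = {(ext x z, ext y z) | z. (path_dom G x, z) \<in> paths G}"
| "gis_rel G Zero = {}"

lemma Zero_in_gis [simp]: "Zero \<in> elts (gis G)"
  by (simp add: gis_def)

lemma Frac_in_gis [simp]: "Frac a b \<in> elts (gis G) \<longleftrightarrow> (a, b) \<in> path_pairs G"
  by (cases a; cases b) (simp add: gis_def path_pairs_def)

lemma gis_times_eq [simp]: "s \<odot>\<^bsub>gis G\<^esub> t = gis_times G s t"
  by (simp add: gis_def)

context wf_digraph
begin

lemma path_head_in_verts: "(v, xs) \<in> paths G \<Longrightarrow> v \<in> verts G"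
  by (simp add: paths_def)

lemma paths_Cons [simp]:
  "(v, e # es) \<in> paths G \<longleftrightarrow> e \<in> arcs G \<and> head G e = v \<and> (tail G e, es) \<in> paths G"
proof -
  have *: "(\<forall>i. Suc i < length (e # es) \<longrightarrow> tail G ((e # es) ! i) = head G ((e # es) ! Suc i)) \<longleftrightarrow>
    (es \<noteq> [] \<longrightarrow> head G (hd es) = tail G e) \<and>
    (\<forall>i. Suc i < length es \<longrightarrow> tail G (es ! i) = head G (es ! Suc i))" (is "(\<forall>i. ?P i) \<longleftrightarrow> _")
  proof -
    have "(\<forall>i. ?P i) \<longleftrightarrow> ?P 0 \<and> (\<forall>i. ?P (Suc i))" by (metis not0_implies_Suc)
    then show ?thesis by (cases es) auto
  qed
  show ?thesis unfolding paths_def mem_Collect_eq prod.case * by (auto simp: head_in_verts tail_in_verts)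
qed

lemma paths_append:
  "(v, xs @ ys) \<in> paths G \<longleftrightarrow> (v, xs) \<in> paths G \<and> (path_dom G (v, xs), ys) \<in> paths G"
  by (induction xs arbitrary: v) (auto dest: path_head_in_verts)

lemma path_dom_append: "path_dom G (v, xs @ ys) = path_dom G (path_dom G (v, xs), ys)"
  by (induction xs arbitrary: v) auto

lemma path_dom_in_verts: "a \<in> paths G \<Longrightarrow> path_dom G a \<in> verts G"
  using paths_append[of "fst a" "snd a" "[]"] by simp

lemma ext_in_paths [simp]: "ext a p \<in> paths G \<longleftrightarrow> a \<in> paths G \<and> (path_dom G a, p) \<in> paths G"
  using paths_append[of "fst a" "snd a" p] by (simp add: ext_def)

lemma path_dom_ext [simp]: "path_dom G (ext a p) = path_dom G (path_dom G a, p)"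
  using path_dom_append[of "fst a" "snd a" p] by (simp add: ext_def)

lemma ext_pair_iff: "(ext a p, ext b p) \<in> path_pairs G \<longleftrightarrow>
    a \<in> paths G \<and> b \<in> paths G \<and> (path_dom G a, p) \<in> paths G \<and> (path_dom G b, p) \<in> paths G \<and>
    path_dom G (path_dom G a, p) = path_dom G (path_dom G b, p)"
  by (auto simp: path_pairs_def)

lemma gis_rel_refl: "(a, b) \<in> path_pairs G \<Longrightarrow> (a, b) \<in> gis_rel G (Frac a b)"
  using path_dom_in_verts by (auto simp: path_pairs_def intro!: exI[of _ "[]"])

lemma gis_rel_path_pairs: "s \<in> elts (gis G) \<Longrightarrow> gis_rel G s \<subseteq> path_pairs G"
  by (cases s) (auto simp: path_pairs_def)

text \<open>The relation of t is closed under extending both coordinates by the same word, so it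
  contains the whole relation of \<open>Frac c d\<close> as soon as it contains the generating pair.
  The natural order is thereby tested on one pair.\<close>

lemma gis_rel_Frac_subset_iff:
  assumes "(c, d) \<in> path_pairs G"
  shows "gis_rel G (Frac c d) \<subseteq> gis_rel G t \<longleftrightarrow> (c, d) \<in> gis_rel G t"
proof
  show "gis_rel G (Frac c d) \<subseteq> gis_rel G t \<Longrightarrow> (c, d) \<in> gis_rel G t"
    using gis_rel_refl[OF assms] by blast
  assume "(c, d) \<in> gis_rel G t"
  then show "gis_rel G (Frac c d) \<subseteq> gis_rel G t"
    by (cases t) (auto simp: paths_append)
qed

section \<open>The product of fractions as composition of relations\<close>

lemma factors_as_ext:
  assumes "ext y z \<in> paths G"
  shows "factors_as G (ext y z) y w \<longleftrightarrow> w = (path_dom G y, z)"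
  using assms by (cases w) (auto simp: factors_as_def path_ran_def path_cat_def ext_def
      paths_append[of "fst y" "snd y" z, simplified])

lemma factors_asD: "factors_as G u y w \<Longrightarrow> u = ext y (snd w)"
  by (simp add: factors_as_def path_cat_def ext_def)

lemma gis_times_left:
  assumes "ext y z \<in> paths G"
  shows "gis_times G (Frac x y) (Frac (ext y z) v) = Frac (ext x z) v"
proof -
  have "(THE w. factors_as G (ext y z) y w) = (path_dom G y, z)"
    by (simp only: factors_as_ext[OF assms] the_eq_trivial)
  moreover have "\<exists>w. factors_as G (ext y z) y w" using factors_as_ext[OF assms] by blast
  ultimately show ?thesis by (simp add: path_cat_def ext_def)
qed

lemma gis_times_right:
  assumes "ext u z \<in> paths G"
  shows "gis_times G (Frac x (ext u z)) (Frac u v) = Frac x (ext v z)"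
\<comment> \<open>For empty z both factorizations exist, and the product is computed by its first
  branch.\<close>
proof (cases "z = []")
  case True
  then show ?thesis using gis_times_left[of u "[]" x v] assms by simp
next
  case False
  have "\<not> factors_as G u (ext u z) w" for w
    using False factors_asD by fastforce
  moreover have "(THE w. factors_as G (ext u z) u w) = (path_dom G u, z)"
    by (simp only: factors_as_ext[OF assms] the_eq_trivial)
  moreover have "\<exists>w. factors_as G (ext u z) u w" using factors_as_ext[OF assms] by blast
  ultimately show ?thesis by (simp add: path_cat_def ext_def)
qed

lemma gis_times_zero:
  assumes "\<And>z. u \<noteq> ext y z" "\<And>z. y \<noteq> ext u z"
  shows "gis_times G (Frac x y) (Frac u v) = Zero"
proof -
  have "\<not> factors_as G u y w" "\<not> factors_as G y u w" for w
    using assms factors_asD by blast+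
  then show ?thesis by simp
qed

lemma gis_cases [case_names left right zero]:
  assumes "\<And>z. u = ext y z \<Longrightarrow> P" "\<And>z. y = ext u z \<Longrightarrow> P"
    "(\<And>z. u \<noteq> ext y z) \<Longrightarrow> (\<And>z. y \<noteq> ext u z) \<Longrightarrow> P"
  shows P
  using assms by blast

lemma gis_rel_comp_left:
  assumes "path_dom G x = path_dom G y" "ext y z \<in> paths G"
  shows "gis_rel G (Frac (ext x z) v) = gis_rel G (Frac x y) O gis_rel G (Frac (ext y z) v)"
proof (intro equalityI subrelI)
  fix a b assume "(a, b) \<in> gis_rel G (Frac (ext x z) v)"
  then obtain p where "a = ext x (z @ p)" "b = ext v p" "(path_dom G (path_dom G x, z), p) \<in> paths G"
    by auto
  then have "(a, ext y (z @ p)) \<in> gis_rel G (Frac x y)" "(ext y (z @ p), b) \<in> gis_rel G (Frac (ext y z) v)"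
    using assms by (auto simp: paths_append)
  then show "(a, b) \<in> gis_rel G (Frac x y) O gis_rel G (Frac (ext y z) v)" by blast
next
  fix a b assume "(a, b) \<in> gis_rel G (Frac x y) O gis_rel G (Frac (ext y z) v)"
  then obtain p q where "a = ext x p" "ext y p = ext y (z @ q)" "b = ext v q"
    "(path_dom G (path_dom G y, z), q) \<in> paths G"
    by auto
  then show "(a, b) \<in> gis_rel G (Frac (ext x z) v)" using assms by auto
qed

lemma gis_rel_converse: "path_dom G x = path_dom G y \<Longrightarrow> (gis_rel G (Frac x y))\<inverse> = gis_rel G (Frac y x)"
  by auto

text \<open>Taking converses exchanges the two factors and reduces this to the left case.\<close>

lemma gis_rel_comp_right:
  assumes "path_dom G x = path_dom G (ext u z)" "path_dom G u = path_dom G v" "ext u z \<in> paths G"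
  shows "gis_rel G (Frac x (ext v z)) = gis_rel G (Frac x (ext u z)) O gis_rel G (Frac u v)"
proof -
  have "(gis_rel G (Frac (ext v z) x))\<inverse> = (gis_rel G (Frac v u) O gis_rel G (Frac (ext u z) x))\<inverse>"
    using assms gis_rel_comp_left[of v u z x] by simp
  then show ?thesis
    using assms by (simp only: converse_relcomp gis_rel_converse path_dom_ext)
qed

lemma gis_times_closed_and_rel:
  assumes "s \<in> elts (gis G)" "t \<in> elts (gis G)"
  shows "gis_times G s t \<in> elts (gis G) \<and> gis_rel G (gis_times G s t) = gis_rel G s O gis_rel G t"
proof (cases "s = Zero \<or> t = Zero")
  case True
  then show ?thesis by (cases s) auto
next
  case False
  then obtain x y u v where st: "s = Frac x y" "t = Frac u v" by (metis gis_elt.exhaust)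
  have xy: "x \<in> paths G" "y \<in> paths G" "path_dom G x = path_dom G y"
    and uv: "u \<in> paths G" "v \<in> paths G" "path_dom G u = path_dom G v"
    using assms st by (auto simp: path_pairs_def)
  show ?thesis
  proof (cases rule: gis_cases[of u y])
    case (left z)
    then have yz: "ext y z \<in> paths G" using uv by simp
    have "gis_times G s t = Frac (ext x z) v"
      unfolding st left using yz by (rule gis_times_left)
    moreover have "(ext x z, v) \<in> path_pairs G"
      using xy uv left by (simp add: path_pairs_def)
    moreover have "gis_rel G (Frac (ext x z) v) = gis_rel G s O gis_rel G t"
      unfolding st left using xy(3) yz by (rule gis_rel_comp_left)
    ultimately show ?thesis by (simp del: gis_rel.simps gis_times.simps)
  next
    case (right z)
    then have uz: "ext u z \<in> paths G" "path_dom G x = path_dom G (ext u z)" using xy by simp_all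
    have "gis_times G s t = Frac x (ext v z)"
      unfolding st right using uz(1) by (rule gis_times_right)
    moreover have "(x, ext v z) \<in> path_pairs G"
      using xy uv right by (simp add: path_pairs_def)
    moreover have "gis_rel G (Frac x (ext v z)) = gis_rel G s O gis_rel G t"
      unfolding st right using uz(2) uv(3) uz(1) by (rule gis_rel_comp_right)
    ultimately show ?thesis by (simp del: gis_rel.simps gis_times.simps)
  next
    case zero
    \<comment> \<open>A common middle path would have both y and u as prefixes, so one of them would
      be a prefix of the other.\<close>
    have "gis_rel G s O gis_rel G t = {}"
    proof (rule equals0I)
      fix c assume "c \<in> gis_rel G s O gis_rel G t"
      then obtain b where "b \<in> snd ` gis_rel G s" "b \<in> fst ` gis_rel G t" by force
      then obtain p q where "ext y p = ext u q" unfolding st by auto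
      then show False by (cases rule: ext_eq_ext) (use zero in blast)+
    qed
    moreover have "gis_times G s t = Zero"
      unfolding st using zero by (intro gis_times_zero)
    ultimately show ?thesis by simp
  qed
qed

text \<open>Associativity of the three-case product is never checked by cases: it is inherited from
  composition of relations.\<close>

sublocale gis: partial_bij_rep "gis G" "gis_rel G"
proof
  show "inj_on (gis_rel G) (elts (gis G))"
  proof (rule inj_onI)
    fix s t assume s: "s \<in> elts (gis G)" and t: "t \<in> elts (gis G)" and eq: "gis_rel G s = gis_rel G t"
    show "s = t"
    proof (cases "s = Zero \<or> t = Zero")
      case True
      then show ?thesis
        using s t eq by (cases s; cases t) (auto dest!: gis_rel_refl simp del: gis_rel.simps(1))
    next
      case False
      then obtain a b c d where st: "s = Frac a b" "t = Frac c d" by (metis gis_elt.exhaust)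
      then have "(a, b) \<in> gis_rel G (Frac c d)" "(c, d) \<in> gis_rel G (Frac a b)"
        using s t eq gis_rel_refl by (metis Frac_in_gis)+
      \<comment> \<open>Each fraction extends the other, so both extending words are empty.\<close>
      then obtain p q where "a = ext c p" "b = ext d p" "c = ext a q" by auto
      then show ?thesis using st by auto
    qed
  qed
  show "partial_bij (gis_rel G s)" if "s \<in> elts (gis G)" for s
  proof (cases s)
    case (Frac x y)
    show ?thesis
    proof (rule partial_bijI)
      fix a b c
      show "b = c" if "(a, b) \<in> gis_rel G s" "(a, c) \<in> gis_rel G s"
        using that unfolding Frac gis_rel.simps mem_Collect_eq prod.inject by (metis ext_cancel_left)
      show "a = b" if "(a, c) \<in> gis_rel G s" "(b, c) \<in> gis_rel G s"
        using that unfolding Frac gis_rel.simps mem_Collect_eq prod.inject by (metis ext_cancel_left)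
    qed
  qed (simp add: partial_bij_def)
  show "\<exists>t\<in>elts (gis G). gis_rel G t = (gis_rel G s)\<inverse>" if "s \<in> elts (gis G)" for s
  proof (cases s)
    case (Frac x y)
    with that have "path_dom G x = path_dom G y" "(y, x) \<in> path_pairs G"
      by (auto simp: path_pairs_def)
    then show ?thesis using gis_rel_converse Frac by (metis Frac_in_gis)
  next
    case Zero
    then show ?thesis by (intro bexI[of _ Zero]) auto
  qed
  show "\<exists>z\<in>elts (gis G). gis_rel G z = {}"
    by (rule bexI[of _ Zero]) auto
qed (use gis_times_closed_and_rel in simp_all)

lemma szero_gis [simp]: "szero (gis G) = Zero"
  using gis.rep_eq_iff[OF gis.szero_closed Zero_in_gis] gis.rep_szero by simp

text \<open>A common pair makes the first coordinates of s and t prefixes of one path, hence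
  comparable. Cancelling the rest of the word shows that the second coordinates differ by the same
  extension.\<close>

lemma gis_rel_overlap:
  assumes "gis_rel G s \<inter> gis_rel G t \<noteq> {}" "s \<in> elts (gis G)" "t \<in> elts (gis G)"
  shows "gis_rel G s \<subseteq> gis_rel G t \<or> gis_rel G t \<subseteq> gis_rel G s"
proof -
  obtain x y u v where st: "s = Frac x y" "t = Frac u v"
    using assms by (metis gis_elt.exhaust gis_rel.simps(2) inf_bot_left inf_bot_right)
  with assms obtain c where "c \<in> gis_rel G (Frac x y)" "c \<in> gis_rel G (Frac u v)"
    by blast
  then obtain p q where pq: "ext x p = ext u q" "ext y p = ext v q"
    unfolding gis_rel.simps mem_Collect_eq by (metis prod.inject)
  have pp: "(x, y) \<in> path_pairs G" "(u, v) \<in> path_pairs G" using assms st by simp_all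
  from pq(1) show ?thesis
  proof (cases rule: ext_eq_ext)
    case (left z)
    then have "ext (ext y z) q = ext v q" using pq by simp
    then have "v = ext y z" by (simp del: ext_ext)
    then have "(u, v) \<in> gis_rel G (Frac x y)" using left pp by (auto simp: path_pairs_def)
    then show ?thesis using gis_rel_Frac_subset_iff pp st by blast
  next
    case (right z)
    then have "ext (ext v z) p = ext y p" using pq by simp
    then have "y = ext v z" by (simp del: ext_ext)
    then have "(x, y) \<in> gis_rel G (Frac u v)" using right pp by (auto simp: path_pairs_def)
    then show ?thesis using gis_rel_Frac_subset_iff pp st by blast
  qed
qed

lemma Frac_exhaust_nonzero:
  assumes "s \<in> elts (gis G)" "s \<noteq> Zero"
  obtains a b where "s = Frac a b" "(a, b) \<in> path_pairs G"
  using assms by (cases s) auto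

text \<open>By comparability of overlapping elements the meet is either zero or the smaller of the
  two, so a nonzero meet amounts to a shared pair.\<close>

lemma smeet_nonzero_iff:
  assumes s: "s \<in> elts (gis G)" and t: "t \<in> elts (gis G)"
  shows "smeet (gis G) s t \<noteq> Zero \<longleftrightarrow> gis_rel G s \<inter> gis_rel G t \<noteq> {}"
proof -
  have smeet_eqI: "smeet (gis G) s t = m" if "is_meet (gis G) s t m" for m
    unfolding smeet_def
  proof (rule the_equality[where P = "is_meet (gis G) s t"])
    fix k assume "is_meet (gis G) s t k"
    with that have "nat_le (gis G) k m" "nat_le (gis G) m k"
      by (simp_all add: is_meet_def nat_le_def)
    then show "k = m" by (rule gis.nat_le_antisym)
  qed fact
  have zero_iff: "m = Zero \<longleftrightarrow> gis_rel G m = {}" if "m \<in> elts (gis G)" for m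
    using gis.eq_szero_iff[OF that] by simp
  consider "gis_rel G s \<inter> gis_rel G t = {}"
    | "gis_rel G s \<inter> gis_rel G t \<noteq> {}" "gis_rel G s \<subseteq> gis_rel G t"
    | "gis_rel G s \<inter> gis_rel G t \<noteq> {}" "gis_rel G t \<subseteq> gis_rel G s"
    using gis_rel_overlap[OF _ s t] by blast
  then show ?thesis
  proof cases
    case 1
    then have "is_meet (gis G) s t Zero"
      using s t by (auto simp: is_meet_def gis.nat_le_iff)
    then show ?thesis using smeet_eqI 1 by simp
  next
    case 2
    then have "is_meet (gis G) s t s"
      using s t by (auto simp: is_meet_def gis.nat_le_iff)
    then show ?thesis using smeet_eqI zero_iff[OF s] 2 by auto
  next
    case 3
    then have "is_meet (gis G) s t t"
      using s t by (auto simp: is_meet_def gis.nat_le_iff)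
    then show ?thesis using smeet_eqI zero_iff[OF t] 3 by auto
  qed
qed

end


section \<open>Finitely generated compatible order ideals\<close>

definition ideal_rel :: "('v, 'e) pre_digraph \<Rightarrow> ('v, 'e) gis_elt set \<Rightarrow> (('v, 'e) path \<times> ('v, 'e) path) set" where
  "ideal_rel G X = \<Union>(gis_rel G ` X)"

lemma DD_iff: "X \<in> elts (DD S) \<longleftrightarrow> (\<exists>A. finite A \<and> A \<noteq> {} \<and> compatible_set S A \<and> X = down S A)"
  by (auto simp: DD_def)

lemma DD_times: "X \<odot>\<^bsub>DD S\<^esub> Y = {x \<odot>\<^bsub>S\<^esub> y | x y. x \<in> X \<and> y \<in> Y}"
  by (simp add: DD_def)

context wf_digraph
begin

lemma ideal_rel_down: "A \<subseteq> elts (gis G) \<Longrightarrow> ideal_rel G (down (gis G) A) = \<Union>(gis_rel G ` A)"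
  by (fastforce simp: ideal_rel_def down_def gis.nat_le_iff)

text \<open>A principal relation covered by a union lies inside a single member, because its
  generating pair does. Hence an ideal can be recovered from its relation; nonemptiness of A takes
  care of \<open>Zero\<close>.\<close>

lemma mem_down_iff:
  assumes "A \<subseteq> elts (gis G)" "A \<noteq> {}"
  shows "s \<in> down (gis G) A \<longleftrightarrow> s \<in> elts (gis G) \<and> gis_rel G s \<subseteq> \<Union>(gis_rel G ` A)"
proof
  assume "s \<in> elts (gis G) \<and> gis_rel G s \<subseteq> \<Union>(gis_rel G ` A)"
  then have s: "s \<in> elts (gis G)" "gis_rel G s \<subseteq> \<Union>(gis_rel G ` A)" by auto
  have "\<exists>t\<in>A. gis_rel G s \<subseteq> gis_rel G t"
  proof (cases "s = Zero")
    case False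
    then obtain a b where ab: "s = Frac a b" "(a, b) \<in> path_pairs G"
      using s Frac_exhaust_nonzero by blast
    then obtain t where "t \<in> A" "(a, b) \<in> gis_rel G t" using s gis_rel_refl by blast
    then show ?thesis using ab gis_rel_Frac_subset_iff by blast
  qed (use assms in auto)
  then show "s \<in> down (gis G) A" using s assms by (auto simp: down_def gis.nat_le_iff)
qed (use assms in \<open>auto simp: down_def gis.nat_le_iff\<close>)

lemma DD_E:
  assumes "X \<in> elts (DD (gis G))"
  obtains A where "finite A" "A \<noteq> {}" "A \<subseteq> elts (gis G)" "X = down (gis G) A"
    "ideal_rel G X = \<Union>(gis_rel G ` A)" "partial_bij (ideal_rel G X)" "compatible_set (gis G) A"
  using assms unfolding DD_iff gis.compatible_set_iff by (metis ideal_rel_down)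

lemma mem_DD_iff:
  assumes "X \<in> elts (DD (gis G))"
  shows "s \<in> X \<longleftrightarrow> s \<in> elts (gis G) \<and> gis_rel G s \<subseteq> ideal_rel G X"
  using DD_E[OF assms] mem_down_iff by metis

lemma DD_I:
  assumes "finite A" "A \<noteq> {}" "A \<subseteq> elts (gis G)" "partial_bij (\<Union>(gis_rel G ` A))"
  shows "down (gis G) A \<in> elts (DD (gis G))"
  using assms by (auto simp: DD_iff gis.compatible_set_iff)

lemma ideal_rel_path_pairs:
  "X \<in> elts (DD (gis G)) \<Longrightarrow> ideal_rel G X \<subseteq> path_pairs G"
  using mem_DD_iff gis_rel_path_pairs unfolding ideal_rel_def by blast

lemma Frac_mem_DD_iff:
  assumes "X \<in> elts (DD (gis G))" "(a, b) \<in> path_pairs G"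
  shows "Frac a b \<in> X \<longleftrightarrow> (a, b) \<in> ideal_rel G X"
proof
  assume "(a, b) \<in> ideal_rel G X"
  then obtain s where "s \<in> X" "(a, b) \<in> gis_rel G s" by (auto simp: ideal_rel_def)
  then have "gis_rel G (Frac a b) \<subseteq> ideal_rel G X"
    using gis_rel_Frac_subset_iff[OF assms(2)] by (auto simp: ideal_rel_def simp del: gis_rel.simps)
  then show "Frac a b \<in> X" using assms mem_DD_iff by simp
next
  assume "Frac a b \<in> X"
  then show "(a, b) \<in> ideal_rel G X"
    unfolding ideal_rel_def using gis_rel_refl[OF assms(2)] by blast
qed

lemma Zero_mem_DD: "X \<in> elts (DD (gis G)) \<Longrightarrow> Zero \<in> X"
  by (simp add: mem_DD_iff)

text \<open>The two coordinates have the same domain, so it suffices that the word extends either of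
  them; which of the two is known varies between the uses.\<close>

lemma ideal_rel_ext:
  assumes X: "X \<in> elts (DD (gis G))" and ab: "(a, b) \<in> ideal_rel G X"
    and z: "(path_dom G a, z) \<in> paths G \<or> (path_dom G b, z) \<in> paths G"
  shows "(ext a z, ext b z) \<in> ideal_rel G X"
proof -
  have pp: "(a, b) \<in> path_pairs G" using X ab ideal_rel_path_pairs by blast
  then have "(path_dom G a, z) \<in> paths G" using z by (auto simp: path_pairs_def)
  then have "(ext a z, ext b z) \<in> gis_rel G (Frac a b)" by auto
  moreover have "Frac a b \<in> X" using Frac_mem_DD_iff X ab pp by simp
  ultimately show ?thesis by (auto simp: ideal_rel_def simp del: gis_rel.simps)
qed

lemma DD_times_down:
  assumes A: "A \<subseteq> elts (gis G)" and B: "B \<subseteq> elts (gis G)"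
  shows "down (gis G) A \<odot>\<^bsub>DD (gis G)\<^esub> down (gis G) B = down (gis G) (\<Union>a\<in>A. gis_times G a ` B)"
proof (intro equalityI subsetI)
  fix s assume "s \<in> down (gis G) A \<odot>\<^bsub>DD (gis G)\<^esub> down (gis G) B"
  then obtain x y a b where s: "s = gis_times G x y" and ab: "a \<in> A" "b \<in> B"
    and "nat_le (gis G) x a" "nat_le (gis G) y b"
    by (auto simp: DD_times down_def)
  then have "x \<in> elts (gis G)" "y \<in> elts (gis G)" "a \<in> elts (gis G)" "b \<in> elts (gis G)"
    "gis_rel G x \<subseteq> gis_rel G a" "gis_rel G y \<subseteq> gis_rel G b"
    by (auto simp: gis.nat_le_iff)
  then have "nat_le (gis G) s (gis_times G a b)"
    unfolding gis.nat_le_iff s by (auto simp: gis_times_closed_and_rel relcomp_mono)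
  then show "s \<in> down (gis G) (\<Union>a\<in>A. gis_times G a ` B)"
    using ab by (auto simp: down_def)
next
  fix s assume "s \<in> down (gis G) (\<Union>a\<in>A. gis_times G a ` B)"
  then obtain a b where ab: "a \<in> A" "b \<in> B" and "nat_le (gis G) s (gis_times G a b)"
    by (auto simp: down_def)
  then obtain e where e: "e \<in> idempotents (gis G)" "s = gis_times G (gis_times G a b) e"
    by (auto simp: nat_le_def)
  have el: "a \<in> elts (gis G)" "b \<in> elts (gis G)" "e \<in> elts (gis G)"
    using ab A B e by (auto simp: gis.idempotents_iff)
  \<comment> \<open>The idempotent that cuts ab down to s is absorbed into the second
    factor.\<close>
  then have "s = gis_times G a (gis_times G b e)"
    using e gis.times_assoc by simp
  moreover have "nat_le (gis G) (gis_times G b e) b"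
    using el e by (auto simp: nat_le_def gis_times_closed_and_rel)
  moreover have "nat_le (gis G) a a" using el by (simp add: gis.nat_le_iff)
  ultimately show "s \<in> down (gis G) A \<odot>\<^bsub>DD (gis G)\<^esub> down (gis G) B"
    using ab unfolding DD_times down_def by auto
qed

text \<open>Composition distributes over unions, so products of generators generate the product
  ideal, and inverses of generators generate the inverse ideal. Injectivity is the recovery of an
  ideal from its relation.\<close>

sublocale DD: partial_bij_rep "DD (gis G)" "ideal_rel G"
proof
  fix X assume X: "X \<in> elts (DD (gis G))"
  then obtain A where A: "finite A" "A \<noteq> {}" "A \<subseteq> elts (gis G)" "X = down (gis G) A"
    "ideal_rel G X = \<Union>(gis_rel G ` A)" "partial_bij (ideal_rel G X)"
    by (rule DD_E)
  show "partial_bij (ideal_rel G X)" by (fact A)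
  have conv: "\<Union>(gis_rel G ` sinv (gis G) ` A) = (ideal_rel G X)\<inverse>"
    using A gis.rep_sinv by (auto simp: subset_iff)
  moreover have "sinv (gis G) ` A \<subseteq> elts (gis G)" using A gis.sinv_closed by blast
  moreover have "partial_bij ((ideal_rel G X)\<inverse>)" using A(6) by (simp add: partial_bij_def)
  ultimately show "\<exists>Y\<in>elts (DD (gis G)). ideal_rel G Y = (ideal_rel G X)\<inverse>"
    using A by (intro bexI[of _ "down (gis G) (sinv (gis G) ` A)"]) (auto simp: ideal_rel_down intro!: DD_I)
  fix Y assume Y: "Y \<in> elts (DD (gis G))"
  then obtain B where B: "finite B" "B \<noteq> {}" "B \<subseteq> elts (gis G)" "Y = down (gis G) B"
    "ideal_rel G Y = \<Union>(gis_rel G ` B)" "partial_bij (ideal_rel G Y)"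
    by (rule DD_E)
  let ?C = "\<Union>a\<in>A. gis_times G a ` B"
  have C: "finite ?C" "?C \<noteq> {}" "?C \<subseteq> elts (gis G)"
    using A B by (auto simp: gis_times_closed_and_rel subset_iff)
  have rel: "\<Union>(gis_rel G ` ?C) = ideal_rel G X O ideal_rel G Y"
    unfolding A(5) B(5) using A(3) B(3) gis_times_closed_and_rel by (fastforce simp: subset_iff)
  have XY: "X \<odot>\<^bsub>DD (gis G)\<^esub> Y = down (gis G) ?C" using DD_times_down A(3,4) B(3,4) by simp
  show "ideal_rel G (X \<odot>\<^bsub>DD (gis G)\<^esub> Y) = ideal_rel G X O ideal_rel G Y"
    unfolding XY using C rel ideal_rel_down by simp
  show "X \<odot>\<^bsub>DD (gis G)\<^esub> Y \<in> elts (DD (gis G))"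
    unfolding XY using C by (rule DD_I) (simp only: rel partial_bij_relcomp[OF A(6) B(6)])
next
  show "inj_on (ideal_rel G) (elts (DD (gis G)))"
    by (rule inj_onI) (auto simp: mem_DD_iff)
  show "\<exists>X\<in>elts (DD (gis G)). ideal_rel G X = {}"
    by (rule bexI[of _ "down (gis G) {Zero}"])
      (auto simp: ideal_rel_down partial_bij_def intro!: DD_I)
qed

lemma DD_principal: "s \<in> elts (gis G) \<Longrightarrow> down (gis G) {s} \<in> elts (DD (gis G))"
  using gis.rep_partial_bij by (intro DD_I) auto

lemma ideal_rel_principal: "s \<in> elts (gis G) \<Longrightarrow> ideal_rel G (down (gis G) {s}) = gis_rel G s"
  by (simp add: ideal_rel_down)

lemma ideal_rel_empty_iff:
  assumes "X \<in> elts (DD (gis G))"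
  shows "X = {Zero} \<longleftrightarrow> ideal_rel G X = {}"
proof
  assume *: "ideal_rel G X = {}"
  have "s = Zero" if "s \<in> X" for s
    using that * assms gis.eq_szero_iff mem_DD_iff[OF assms, of s] by simp
  then show "X = {Zero}" using Zero_mem_DD[OF assms] by blast
qed (simp add: ideal_rel_def)

text \<open>The finite generating sets of the members together generate \<open>\<Union>F\<close>,
  and the hypothesis on the relations says that these generators are compatible.\<close>

lemma Union_DD:
  assumes F: "finite F" "F \<noteq> {}" "F \<subseteq> elts (DD (gis G))" and pb: "partial_bij (\<Union>(ideal_rel G ` F))"
  shows "\<Union>F \<in> elts (DD (gis G))" "ideal_rel G (\<Union>F) = \<Union>(ideal_rel G ` F)"
proof -
  have "\<forall>X\<in>F. \<exists>A. finite A \<and> A \<noteq> {} \<and> A \<subseteq> elts (gis G) \<and> X = down (gis G) A"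
    using F(3) by (meson DD_E subsetD)
  then obtain A where A: "\<And>X. X \<in> F \<Longrightarrow> finite (A X) \<and> A X \<noteq> {} \<and> A X \<subseteq> elts (gis G) \<and> X = down (gis G) (A X)"
    by metis
  have eq: "\<Union>F = down (gis G) (\<Union>X\<in>F. A X)" using A by (fastforce simp: down_def)
  have sub: "(\<Union>X\<in>F. A X) \<subseteq> elts (gis G)" using A by blast
  show *: "ideal_rel G (\<Union>F) = \<Union>(ideal_rel G ` F)" by (auto simp: ideal_rel_def)
  then have "\<Union>(gis_rel G ` (\<Union>X\<in>F. A X)) = \<Union>(ideal_rel G ` F)"
    using eq sub ideal_rel_down by simp
  then show "\<Union>F \<in> elts (DD (gis G))"
    unfolding eq using F A sub pb by (intro DD_I) auto
qed

end


section \<open>The Cuntz-Krieger congruence\<close>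

text \<open>The arrow in coordinates: every nonzero element of R has a nonzero lower bound in Q.
  There is no separate quantifier over elements below (a, b), because the relations to which this is
  applied are closed under extension.\<close>

definition dense_below :: "(('v, 'e) path \<times> ('v, 'e) path) set \<Rightarrow> (('v, 'e) path \<times> ('v, 'e) path) set \<Rightarrow> bool" where
  "dense_below R Q \<longleftrightarrow> (\<forall>a b. (a, b) \<in> R \<longrightarrow> (\<exists>z. (ext a z, ext b z) \<in> Q))"

lemma dense_below_mono: "\<lbrakk>dense_below R Q; Q \<subseteq> Q'\<rbrakk> \<Longrightarrow> dense_below R Q'"
  unfolding dense_below_def by blast

lemma subset_dense_below: "R \<subseteq> Q \<Longrightarrow> dense_below R Q"
  unfolding dense_below_def by (metis ext_Nil subsetD)

lemma dense_below_trans: "\<lbrakk>dense_below R Q; dense_below Q P\<rbrakk> \<Longrightarrow> dense_below R P"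
  unfolding dense_below_def by (metis ext_ext)

lemma dense_below_Union: "dense_below (\<Union>F) Q \<longleftrightarrow> (\<forall>R\<in>F. dense_below R Q)"
  unfolding dense_below_def by blast

lemma dense_below_empty_iff: "dense_below R {} \<longleftrightarrow> R = {}"
  unfolding dense_below_def by auto

context wf_digraph
begin

text \<open>The nonzero elements below a generator are the pairs of its relation, and a nonzero meet
  of \<open>Frac c d\<close> with t is an extension of (c, d) in the relation of t. Only the unions
  survive on the right, so the choice of generators disappears.\<close>

lemma arrow_iff:
  assumes A: "A \<subseteq> elts (gis G)" and B: "B \<subseteq> elts (gis G)"
  shows "arrow (gis G) A B \<longleftrightarrow> dense_below (\<Union>(gis_rel G ` A)) (\<Union>(gis_rel G ` B))"
proof
  assume ar: "arrow (gis G) A B"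
  show "dense_below (\<Union>(gis_rel G ` A)) (\<Union>(gis_rel G ` B))"
    unfolding dense_below_def
  proof (intro allI impI)
    fix c d assume "(c, d) \<in> \<Union>(gis_rel G ` A)"
    then obtain s where s: "s \<in> A" "(c, d) \<in> gis_rel G s" by blast
    have cd: "(c, d) \<in> path_pairs G" using s A gis_rel_path_pairs by blast
    then have "nat_le (gis G) (Frac c d) s"
      using s A gis_rel_Frac_subset_iff by (auto simp: gis.nat_le_iff simp del: gis_rel.simps)
    then obtain t where t: "t \<in> B" "smeet (gis G) (Frac c d) t \<noteq> Zero"
      using ar[unfolded arrow_def, rule_format, OF s(1), of "Frac c d"] cd by auto
    then have "t \<in> elts (gis G)" using B by blast
    then have "gis_rel G (Frac c d) \<inter> gis_rel G t \<noteq> {}"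
      using smeet_nonzero_iff[of "Frac c d" t] cd t(2) by simp
    then obtain z where "(ext c z, ext d z) \<in> gis_rel G t" unfolding gis_rel.simps by blast
    then show "\<exists>z. (ext c z, ext d z) \<in> \<Union>(gis_rel G ` B)" using t by blast
  qed
next
  assume d: "dense_below (\<Union>(gis_rel G ` A)) (\<Union>(gis_rel G ` B))"
  show "arrow (gis G) A B"
    unfolding arrow_def szero_gis
  proof (intro ballI impI, elim conjE)
    fix s x assume s: "s \<in> A" and x: "x \<in> elts (gis G)" "x \<noteq> Zero" "nat_le (gis G) x s"
    then obtain a b where ab: "x = Frac a b" "(a, b) \<in> path_pairs G"
      by (meson Frac_exhaust_nonzero)
    have "gis_rel G x \<subseteq> gis_rel G s" using x(3) by (simp add: gis.nat_le_iff)
    then have "(a, b) \<in> gis_rel G s" using ab gis_rel_refl by blast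
    then obtain z t where t: "t \<in> B" and z: "(ext a z, ext b z) \<in> gis_rel G t"
      using d s unfolding dense_below_def by blast
    then have "(ext a z, ext b z) \<in> path_pairs G" using B gis_rel_path_pairs by blast
    then have "(path_dom G a, z) \<in> paths G" by (simp add: ext_pair_iff)
    then have "(ext a z, ext b z) \<in> gis_rel G x" unfolding ab gis_rel.simps by blast
    then show "\<exists>t\<in>B. smeet (gis G) x t \<noteq> Zero"
      using smeet_nonzero_iff x t z B by blast
  qed
qed

text \<open>Incomparable elements have disjoint relations. For compatible elements a shared first or
  second component would already be a shared pair.\<close>

lemma compatible_orthogonal:
  assumes "compatible_set (gis G) A" "s \<in> A" "t \<in> A"
    and "\<not> gis_rel G s \<subseteq> gis_rel G t" "\<not> gis_rel G t \<subseteq> gis_rel G s"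
  shows "orthogonal (gis G) s t"
proof -
  have el: "s \<in> elts (gis G)" "t \<in> elts (gis G)" using assms by (auto simp: compatible_set_def)
  then have dis: "gis_rel G s \<inter> gis_rel G t = {}" using assms gis_rel_overlap by blast
  have c: "(gis_rel G s)\<inverse> O gis_rel G t \<subseteq> Id" "gis_rel G s O (gis_rel G t)\<inverse> \<subseteq> Id"
    using assms(1-3) gis.compatible_iff[OF el] unfolding compatible_set_def by blast+
  have "(gis_rel G s)\<inverse> O gis_rel G t = {}"
  proof (rule equals0I)
    fix c assume "c \<in> (gis_rel G s)\<inverse> O gis_rel G t"
    then obtain a b d where "(a, b) \<in> gis_rel G s" "(a, d) \<in> gis_rel G t" by blast
    then show False using c(1) dis by blast
  qed
  moreover have "gis_rel G s O (gis_rel G t)\<inverse> = {}"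
  proof (rule equals0I)
    fix c assume "c \<in> gis_rel G s O (gis_rel G t)\<inverse>"
    then obtain a b d where "(a, d) \<in> gis_rel G s" "(b, d) \<in> gis_rel G t" by blast
    then show False using c(2) dis by blast
  qed
  ultimately show ?thesis using el by (simp add: gis.orthogonal_iff)
qed

text \<open>If a generator s lies below t in X, then a generator above t shares a pair with s and
  must be s itself by orthogonality; so generators are maximal. As the right-hand side mentions X
  only, orthogonal generating sets are unique.\<close>

lemma orthogonal_generators_eq:
  assumes A: "A \<subseteq> elts (gis G) - {Zero}" "\<forall>s\<in>A. \<forall>t\<in>A. s \<noteq> t \<longrightarrow> orthogonal (gis G) s t"
    and X: "X = down (gis G) A"
  shows "A = {s \<in> X. \<forall>t\<in>X. gis_rel G s \<subseteq> gis_rel G t \<longrightarrow> s = t}"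
proof (intro equalityI subsetI)
  fix s assume s: "s \<in> A"
  then have sel: "s \<in> elts (gis G)" "s \<noteq> Zero" using A(1) by auto
  have sX: "s \<in> X" using s gis.nat_le_refl[OF sel(1)] unfolding X down_def by blast
  have "s = t" if t: "t \<in> X" "gis_rel G s \<subseteq> gis_rel G t" for t
  proof -
    obtain u where u: "u \<in> A" "gis_rel G t \<subseteq> gis_rel G u" "t \<in> elts (gis G)"
      using t by (auto simp: X down_def gis.nat_le_iff)
    obtain a b where "(a, b) \<in> gis_rel G s"
      using sel gis.eq_szero_iff[of s] by auto
    then have ne: "(gis_rel G s)\<inverse> O gis_rel G u \<noteq> {}" using u(2) t(2) by blast
    have "u \<in> elts (gis G)" using u(1) A(1) by blast
    then have "s = u" using A(2) s u(1) ne gis.orthogonal_iff[OF sel(1)] by blast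
    then have "gis_rel G s = gis_rel G t" using u(2) t(2) by blast
    then show ?thesis using gis.rep_eq_iff[OF sel(1) u(3)] by simp
  qed
  then show "s \<in> {s \<in> X. \<forall>t\<in>X. gis_rel G s \<subseteq> gis_rel G t \<longrightarrow> s = t}" using sX by blast
next
  fix s assume s: "s \<in> {s \<in> X. \<forall>t\<in>X. gis_rel G s \<subseteq> gis_rel G t \<longrightarrow> s = t}"
  then obtain t where t: "t \<in> A" "gis_rel G s \<subseteq> gis_rel G t" "t \<in> elts (gis G)"
    by (auto simp: X down_def gis.nat_le_iff)
  then have "t \<in> X" using gis.nat_le_refl[OF t(3)] unfolding X down_def by blast
  then show "s \<in> A" using s t by blast
qed

lemma orth_gens_props:
  assumes X: "X \<in> elts (DD (gis G))" "X \<noteq> {Zero}"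
  shows "orth_gens (gis G) X \<subseteq> elts (gis G)" "ideal_rel G X = \<Union>(gis_rel G ` orth_gens (gis G) X)"
proof -
  let ?P = "\<lambda>A. finite A \<and> A \<subseteq> elts (gis G) - {Zero} \<and>
     (\<forall>s\<in>A. \<forall>t\<in>A. s \<noteq> t \<longrightarrow> orthogonal (gis G) s t) \<and> X = down (gis G) A"
  obtain A where A: "finite A" "A \<noteq> {}" "A \<subseteq> elts (gis G)" "X = down (gis G) A"
    "ideal_rel G X = \<Union>(gis_rel G ` A)" "partial_bij (ideal_rel G X)" "compatible_set (gis G) A"
    using X by (meson DD_E)
  \<comment> \<open>Zero and every generator lying below a different one are discarded. As A is
    finite, each nonzero generator is below a maximal one, so the generated ideal does not
    change.\<close>
  define B where "B = {s \<in> A - {Zero}. \<forall>t\<in>A - {Zero}. gis_rel G s \<subseteq> gis_rel G t \<longrightarrow> s = t}"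
  have le_B: "\<exists>t\<in>B. gis_rel G s \<subseteq> gis_rel G t" if s: "s \<in> A - {Zero}" for s
  proof -
    obtain R where R: "R \<in> gis_rel G ` (A - {Zero})" "gis_rel G s \<subseteq> R"
        "\<forall>Q\<in>gis_rel G ` (A - {Zero}). R \<subseteq> Q \<longrightarrow> R = Q"
      using finite_has_maximal2[of "gis_rel G ` (A - {Zero})" "gis_rel G s"] s A(1) by blast
    then obtain t where t: "t \<in> A - {Zero}" "R = gis_rel G t" by blast
    have "t = u" if u: "u \<in> A - {Zero}" "gis_rel G t \<subseteq> gis_rel G u" for u
    proof -
      have "t \<in> elts (gis G)" "u \<in> elts (gis G)" using t(1) u(1) A(3) by auto
      moreover have "gis_rel G t = gis_rel G u" using R(3) t(2) u by simp
      ultimately show ?thesis using gis.rep_eq_iff by simp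
    qed
    then have "t \<in> B" using t(1) unfolding B_def by blast
    then show ?thesis using R(2) t(2) by blast
  qed
  have "A - {Zero} \<noteq> {}"
    using A X ideal_rel_empty_iff[OF X(1)] by fastforce
  then have Bne: "B \<noteq> {}" using le_B by blast
  have Bsub: "B \<subseteq> A" "B \<subseteq> elts (gis G) - {Zero}" using A(3) by (auto simp: B_def)
  have "\<Union>(gis_rel G ` A) = \<Union>(gis_rel G ` B)"
  proof
    show "\<Union>(gis_rel G ` A) \<subseteq> \<Union>(gis_rel G ` B)"
    proof
      fix c assume "c \<in> \<Union>(gis_rel G ` A)"
      then obtain s where s: "s \<in> A" "c \<in> gis_rel G s" by blast
      then have "s \<noteq> Zero" by auto
      then show "c \<in> \<Union>(gis_rel G ` B)" using le_B s by blast
    qed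
  qed (use Bsub in blast)
  moreover have "B \<subseteq> elts (gis G)" using Bsub(2) by blast
  ultimately have XB: "X = down (gis G) B"
    unfolding A(4) using mem_down_iff[OF A(3,2)] mem_down_iff[OF _ Bne] by (intro set_eqI) simp
  have "orthogonal (gis G) s t" if "s \<in> B" "t \<in> B" "s \<noteq> t" for s t
  proof (rule compatible_orthogonal[OF A(7)])
    show "s \<in> A" "t \<in> A" using that(1,2) Bsub(1) by blast+
    show "\<not> gis_rel G s \<subseteq> gis_rel G t" "\<not> gis_rel G t \<subseteq> gis_rel G s"
      using that unfolding B_def by blast+
  qed
  then have PB: "?P B" using finite_subset[OF Bsub(1) A(1)] Bsub(2) XB by simp
  have "C = B" if "?P C" for C
    using orthogonal_generators_eq[of C X] orthogonal_generators_eq[of B X] that PB by simp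
  then have "orth_gens (gis G) X = B"
    unfolding orth_gens_def szero_gis using the_equality[of ?P, OF PB] by blast
  then show "orth_gens (gis G) X \<subseteq> elts (gis G)" "ideal_rel G X = \<Union>(gis_rel G ` orth_gens (gis G) X)"
    using Bsub A(5) \<open>\<Union>(gis_rel G ` A) = \<Union>(gis_rel G ` B)\<close> by auto
qed

text \<open>The separate clause for the zero ideal is absorbed: only the empty relation is dense
  below the empty relation.\<close>

lemma ck_rel_iff:
  "(X, Y) \<in> ck_rel (gis G) \<longleftrightarrow> X \<in> elts (DD (gis G)) \<and> Y \<in> elts (DD (gis G)) \<and>
     dense_below (ideal_rel G X) (ideal_rel G Y) \<and> dense_below (ideal_rel G Y) (ideal_rel G X)"
proof (cases "X \<in> elts (DD (gis G)) \<and> Y \<in> elts (DD (gis G))")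
  case True
  then have X: "X \<in> elts (DD (gis G))" and Y: "Y \<in> elts (DD (gis G))" by auto
  show ?thesis
  proof (cases "X = {Zero} \<or> Y = {Zero}")
    case True
    then show ?thesis
      using X Y ideal_rel_empty_iff[OF X] ideal_rel_empty_iff[OF Y]
      by (auto simp: ck_rel_def dense_below_empty_iff)
  next
    case False
    then show ?thesis
      using X Y orth_gens_props[OF X] orth_gens_props[OF Y] by (simp add: ck_rel_def arrow_iff)
  qed
qed (auto simp: ck_rel_def)

lemma equiv_ck_rel: "equiv (elts (DD (gis G))) (ck_rel (gis G))"
  by (rule equivI)
    (auto simp: refl_on_def sym_def trans_def ck_rel_iff subset_dense_below intro: dense_below_trans)

text \<open>Extend the first pair into X', carry the same word along the pair of Y, extend further
  into Y', and carry the second word back along X'. The middle paths then match again.\<close>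

lemma dense_below_times:
  assumes "X \<in> elts (DD (gis G))" "X' \<in> elts (DD (gis G))" "Y \<in> elts (DD (gis G))" "Y' \<in> elts (DD (gis G))"
    and "dense_below (ideal_rel G X) (ideal_rel G X')" "dense_below (ideal_rel G Y) (ideal_rel G Y')"
  shows "dense_below (ideal_rel G X O ideal_rel G Y) (ideal_rel G X' O ideal_rel G Y')"
  unfolding dense_below_def
proof (intro allI impI)
  fix a b assume "(a, b) \<in> ideal_rel G X O ideal_rel G Y"
  then obtain c where ac: "(a, c) \<in> ideal_rel G X" and cb: "(c, b) \<in> ideal_rel G Y" by blast
  obtain z where z: "(ext a z, ext c z) \<in> ideal_rel G X'"
    using assms(5) ac unfolding dense_below_def by blast
  then have "(path_dom G c, z) \<in> paths G"
    using ideal_rel_path_pairs[OF assms(2)] by (auto simp: ext_pair_iff)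
  then have "(ext c z, ext b z) \<in> ideal_rel G Y" using ideal_rel_ext assms(3) cb by blast
  then obtain w where w: "(ext c (z @ w), ext b (z @ w)) \<in> ideal_rel G Y'"
    using assms(6) unfolding dense_below_def by (metis ext_ext)
  then have "(path_dom G (ext c z), w) \<in> paths G"
    using ideal_rel_path_pairs[OF assms(4)] by (auto simp: ext_pair_iff paths_append)
  then have "(ext a (z @ w), ext c (z @ w)) \<in> ideal_rel G X'"
    using ideal_rel_ext[OF assms(2) z, of w] by simp
  then show "\<exists>z. (ext a z, ext b z) \<in> ideal_rel G X' O ideal_rel G Y'" using w by blast
qed

section \<open>The quotient semigroup, its order and its joins\<close>

definition ck_class :: "('a, 'b) gis_elt set \<Rightarrow> ('a, 'b) gis_elt set set" where
  "ck_class X = ck_rel (gis G) `` {X}"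

lemma ck_class_eq_iff:
  assumes "X \<in> elts (DD (gis G))" "Y \<in> elts (DD (gis G))"
  shows "ck_class X = ck_class Y \<longleftrightarrow>
    dense_below (ideal_rel G X) (ideal_rel G Y) \<and> dense_below (ideal_rel G Y) (ideal_rel G X)"
  using assms eq_equiv_class_iff[OF equiv_ck_rel] by (simp add: ck_class_def ck_rel_iff)

lemma elts_CK: "elts (CK G) = ck_class ` elts (DD (gis G))"
  by (auto simp: CK_def quotient_def ck_class_def)

lemma ck_map_eq: "ck_map G s = ck_class (down (gis G) {s})"
  by (simp add: ck_map_def ck_class_def)

lemma ck_class_times:
  assumes "X \<in> elts (DD (gis G))" "Y \<in> elts (DD (gis G))"
  shows "ck_class X \<odot>\<^bsub>CK G\<^esub> ck_class Y = ck_class (X \<odot>\<^bsub>DD (gis G)\<^esub> Y)"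
proof -
  have "congruent2 (ck_rel (gis G)) (ck_rel (gis G)) (\<lambda>X Y. ck_rel (gis G) `` {X \<odot>\<^bsub>DD (gis G)\<^esub> Y})"
  proof (rule congruent2I'; goal_cases)
    case (1 X X' Y Y')
    then have "ck_class (X \<odot>\<^bsub>DD (gis G)\<^esub> Y) = ck_class (X' \<odot>\<^bsub>DD (gis G)\<^esub> Y')"
      by (simp add: ck_class_eq_iff ck_rel_iff DD.rep_closed DD.rep_times dense_below_times)
    then show ?case by (simp add: ck_class_def)
  qed
  from UN_equiv_class2[OF equiv_ck_rel equiv_ck_rel this assms]
  show ?thesis by (simp add: CK_def ck_class_def)
qed

lemma elts_CK_E:
  assumes "c \<in> elts (CK G)"
  obtains X where "X \<in> elts (DD (gis G))" "c = ck_class X"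
  using assms by (auto simp: elts_CK)

lemma ck_class_closed: "X \<in> elts (DD (gis G)) \<Longrightarrow> ck_class X \<in> elts (CK G)"
  by (simp add: elts_CK)

text \<open>If \<open>(xz, yz)\<close> lies in \<open>R\<close> and in \<open>R O R\<close> for a partial bijection \<open>R\<close>, then \<open>xz = yz\<close> and so \<open>x = y\<close>.\<close>

lemma ck_class_idempotent_iff:
  assumes X: "X \<in> elts (DD (gis G))"
  shows "ck_class X \<in> idempotents (CK G) \<longleftrightarrow> ideal_rel G X \<subseteq> Id"
proof
  assume "ck_class X \<in> idempotents (CK G)"
  then have "ck_class X = ck_class (X \<odot>\<^bsub>DD (gis G)\<^esub> X)"
    by (simp add: idempotents_def ck_class_times X)
  then have d: "dense_below (ideal_rel G X) (ideal_rel G X O ideal_rel G X)"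
    by (simp add: ck_class_eq_iff X DD.rep_closed DD.rep_times)
  have pb: "partial_bij (ideal_rel G X)" using X by (rule DD.rep_partial_bij)
  show "ideal_rel G X \<subseteq> Id"
  proof (rule subrelI)
    fix a b assume ab: "(a, b) \<in> ideal_rel G X"
    then obtain z where z: "(ext a z, ext b z) \<in> ideal_rel G X O ideal_rel G X"
      using d unfolding dense_below_def by blast
    then obtain c where c: "(ext a z, c) \<in> ideal_rel G X" "(c, ext b z) \<in> ideal_rel G X" by blast
    have "ext a z \<in> paths G" using ideal_rel_path_pairs[OF X] c(1) by (auto simp: path_pairs_def)
    then have "(ext a z, ext b z) \<in> ideal_rel G X" using ideal_rel_ext[OF X ab] by simp
    moreover from this have "c = ext b z" using partial_bijD1[OF pb] c(1) by blast
    ultimately have "ext a z = ext b z" using partial_bijD2[OF pb] c(2) by blast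
    then show "(a, b) \<in> Id" by simp
  qed
next
  assume "ideal_rel G X \<subseteq> Id"
  then have "X \<in> idempotents (DD (gis G))" using X by (simp add: DD.idempotents_iff)
  then show "ck_class X \<in> idempotents (CK G)"
    using X by (simp add: idempotents_def ck_class_times ck_class_closed)
qed

lemma ck_class_inverse:
  assumes X: "X \<in> elts (DD (gis G))"
  shows "is_inverse (CK G) (ck_class X) (ck_class (sinv (DD (gis G)) X))"
  using DD.is_inverse_sinv[OF X] X
  by (simp add: is_inverse_def ck_class_closed ck_class_times DD.rep_closed)

text \<open>Inverses and zero are classes of those in \<open>DD (gis G)\<close>. Idempotents commute
  because, by \<open>ck_class_idempotent_iff\<close>, every representative of an idempotent class is
  itself idempotent.\<close>

sublocale CK: inverse_semigroup "CK G"
proof (rule inverse_semigroupI)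
  fix a b assume a: "a \<in> elts (CK G)" and b: "b \<in> elts (CK G)"
  obtain X Y where X: "X \<in> elts (DD (gis G))" "a = ck_class X" and Y: "Y \<in> elts (DD (gis G))" "b = ck_class Y"
    using a b by (meson elts_CK_E)
  show "a \<odot>\<^bsub>CK G\<^esub> b \<in> elts (CK G)"
    using X Y by (simp add: ck_class_times ck_class_closed DD.rep_closed)
  show "\<exists>b. is_inverse (CK G) a b" using X ck_class_inverse by blast
  fix c assume "c \<in> elts (CK G)"
  then obtain Z where "Z \<in> elts (DD (gis G))" "c = ck_class Z" by (rule elts_CK_E)
  then show "(a \<odot>\<^bsub>CK G\<^esub> b) \<odot>\<^bsub>CK G\<^esub> c = a \<odot>\<^bsub>CK G\<^esub> (b \<odot>\<^bsub>CK G\<^esub> c)"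
    using X Y by (simp add: ck_class_times DD.rep_closed DD.times_assoc)
next
  fix e f assume e: "e \<in> idempotents (CK G)" and f: "f \<in> idempotents (CK G)"
  then have "e \<in> elts (CK G)" "f \<in> elts (CK G)" by (simp_all add: idempotents_def)
  then obtain X Y where X: "X \<in> elts (DD (gis G))" "e = ck_class X" and Y: "Y \<in> elts (DD (gis G))" "f = ck_class Y"
    by (meson elts_CK_E)
  then have "X \<in> idempotents (DD (gis G))" "Y \<in> idempotents (DD (gis G))"
    using e f by (simp_all add: ck_class_idempotent_iff DD.idempotents_iff)
  then show "e \<odot>\<^bsub>CK G\<^esub> f = f \<odot>\<^bsub>CK G\<^esub> e"
    using X Y by (simp add: ck_class_times DD.idempotents_commute)
next
  have z: "szero (DD (gis G)) \<in> elts (DD (gis G))" by (rule DD.szero_closed)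
  have "is_zero (DD (gis G)) (szero (DD (gis G)))"
    using DD.is_zero_rep[OF z DD.rep_szero] .
  then have "is_zero (CK G) (ck_class (szero (DD (gis G))))"
    unfolding is_zero_def by (auto simp: elts_CK ck_class_times z)
  then show "\<exists>z. is_zero (CK G) z" ..
qed

text \<open>Multiplying Y by an idempotent ideal only shrinks its relation, which gives one
  direction. For the other, an idempotent has to be found that cuts Y down to X up to
  density.\<close>

lemma ck_class_le_iff:
  assumes X: "X \<in> elts (DD (gis G))" and Y: "Y \<in> elts (DD (gis G))"
  shows "nat_le (CK G) (ck_class X) (ck_class Y) \<longleftrightarrow> dense_below (ideal_rel G X) (ideal_rel G Y)"
proof
  assume "nat_le (CK G) (ck_class X) (ck_class Y)"
  then obtain e where e: "e \<in> idempotents (CK G)" "ck_class X = ck_class Y \<odot>\<^bsub>CK G\<^esub> e"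
    by (auto simp: nat_le_def)
  then obtain E where E: "E \<in> elts (DD (gis G))" "e = ck_class E"
    by (meson CK.idempotents_closed elts_CK_E)
  then have "ideal_rel G E \<subseteq> Id" using e ck_class_idempotent_iff by simp
  then have "ideal_rel G Y O ideal_rel G E \<subseteq> ideal_rel G Y" by blast
  moreover have "ck_class X = ck_class (Y \<odot>\<^bsub>DD (gis G)\<^esub> E)"
    using e(2) E Y by (simp add: ck_class_times)
  then have "dense_below (ideal_rel G X) (ideal_rel G Y O ideal_rel G E)"
    using X Y E by (simp add: ck_class_eq_iff DD.rep_closed DD.rep_times)
  ultimately show "dense_below (ideal_rel G X) (ideal_rel G Y)"
    using dense_below_mono by blast
next
  assume d: "dense_below (ideal_rel G X) (ideal_rel G Y)"
  \<comment> \<open>The same witness as for the order on relations; here the relation of X need not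
    be contained in that of Y, so the equality holds only after extension.\<close>
  define E where "E = sinv (DD (gis G)) X \<odot>\<^bsub>DD (gis G)\<^esub> X"
  have E: "E \<in> elts (DD (gis G))" "ideal_rel G E = (ideal_rel G X)\<inverse> O ideal_rel G X"
    unfolding E_def using X by (simp_all add: DD.rep_closed DD.rep_times DD.sinv_closed DD.rep_sinv)
  have pbX: "partial_bij (ideal_rel G X)" and pbY: "partial_bij (ideal_rel G Y)"
    using X Y DD.rep_partial_bij by auto
  have E_Id: "ideal_rel G E \<subseteq> Id" unfolding E(2) using partial_bijD1[OF pbX] by blast
  have 1: "dense_below (ideal_rel G X) (ideal_rel G Y O ideal_rel G E)"
    unfolding dense_below_def
  proof (intro allI impI)
    fix a b assume ab: "(a, b) \<in> ideal_rel G X"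
    then obtain z where z: "(ext a z, ext b z) \<in> ideal_rel G Y"
      using d unfolding dense_below_def by blast
    then have "ext a z \<in> paths G" using ideal_rel_path_pairs[OF Y] by (auto simp: path_pairs_def)
    then have "(ext a z, ext b z) \<in> ideal_rel G X" using ideal_rel_ext[OF X ab] by simp
    then have "(ext b z, ext b z) \<in> ideal_rel G E" unfolding E(2) by blast
    then show "\<exists>z. (ext a z, ext b z) \<in> ideal_rel G Y O ideal_rel G E" using z by blast
  qed
  have 2: "dense_below (ideal_rel G Y O ideal_rel G E) (ideal_rel G X)"
    unfolding dense_below_def
  proof (intro allI impI)
    fix a b assume "(a, b) \<in> ideal_rel G Y O ideal_rel G E"
    then obtain b' where "(a, b') \<in> ideal_rel G Y" "(b', b) \<in> ideal_rel G E" by blast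
    then have ab: "(a, b) \<in> ideal_rel G Y" and "(b, b) \<in> ideal_rel G E" using E_Id by blast+
    then obtain c where cb: "(c, b) \<in> ideal_rel G X" unfolding E(2) by blast
    then obtain z where z: "(ext c z, ext b z) \<in> ideal_rel G Y"
      using d unfolding dense_below_def by blast
    then have bz: "ext b z \<in> paths G" using ideal_rel_path_pairs[OF Y] by (auto simp: path_pairs_def)
    then have "(ext a z, ext b z) \<in> ideal_rel G Y" using ideal_rel_ext[OF Y ab] by simp
    \<comment> \<open>Two pairs of Y with the same second coordinate: injectivity of Y identifies
      the given pair, once extended, with one that X contains.\<close>
    then have "ext a z = ext c z" using partial_bijD2[OF pbY] z by blast
    moreover have "(ext c z, ext b z) \<in> ideal_rel G X" using ideal_rel_ext[OF X cb] bz by simp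
    ultimately show "\<exists>z. (ext a z, ext b z) \<in> ideal_rel G X" by metis
  qed
  have "ck_class X = ck_class Y \<odot>\<^bsub>CK G\<^esub> ck_class E"
    using X Y E(1) 1 2 by (simp add: ck_class_times ck_class_eq_iff DD.rep_closed DD.rep_times)
  moreover have "ck_class E \<in> idempotents (CK G)" using E_Id E(1) by (simp add: ck_class_idempotent_iff)
  ultimately show "nat_le (CK G) (ck_class X) (ck_class Y)"
    using X Y ck_class_closed unfolding nat_le_def by blast
qed

text \<open>Compatibility asks that two products be idempotent, and idempotency is reflected by
  classes. Hence representatives of compatible classes can be united.\<close>

lemma ck_class_compatible_iff:
  assumes X: "X \<in> elts (DD (gis G))" and Y: "Y \<in> elts (DD (gis G))"
  shows "compatible (CK G) (ck_class X) (ck_class Y) \<longleftrightarrow> compatible (DD (gis G)) X Y"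
proof -
  have sinv: "sinv (CK G) (ck_class X) = ck_class (sinv (DD (gis G)) X)"
    if "X \<in> elts (DD (gis G))" for X
    using CK.sinv_eqI[OF ck_class_closed[OF that] ck_class_inverse[OF that]] .
  show ?thesis
    using X Y by (simp add: compatible_def sinv ck_class_times DD.sinv_closed DD.rep_closed
        ck_class_idempotent_iff DD.idempotents_iff)
qed

lemma ck_class_compatible_set_iff:
  assumes "F \<subseteq> elts (DD (gis G))"
  shows "compatible_set (CK G) (ck_class ` F) \<longleftrightarrow> partial_bij (\<Union>(ideal_rel G ` F))"
proof -
  have "compatible_set (CK G) (ck_class ` F) \<longleftrightarrow> compatible_set (DD (gis G)) F"
    using assms ck_class_compatible_iff ck_class_closed by (auto simp: compatible_set_def subset_iff)
  then show ?thesis using assms DD.compatible_set_iff by simp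
qed

lemma ck_class_Union_join:
  assumes F: "finite F" "F \<noteq> {}" "F \<subseteq> elts (DD (gis G))" and pb: "partial_bij (\<Union>(ideal_rel G ` F))"
  shows "is_join (CK G) (ck_class ` F) (ck_class (\<Union>F))"
proof -
  note U = Union_DD[OF F pb]
  show ?thesis unfolding is_join_def
  proof (intro conjI ballI impI)
    show "ck_class (\<Union>F) \<in> elts (CK G)" using U ck_class_closed by blast
    fix a assume "a \<in> ck_class ` F"
    then obtain X where X: "X \<in> F" "a = ck_class X" by blast
    then have "dense_below (ideal_rel G X) (ideal_rel G (\<Union>F))"
      using U(2) by (intro subset_dense_below) auto
    then show "nat_le (CK G) a (ck_class (\<Union>F))"
      using X F(3) U(1) ck_class_le_iff by blast
  next
    fix u assume u: "u \<in> elts (CK G)" and le: "\<forall>a\<in>ck_class ` F. nat_le (CK G) a u"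
    obtain V where V: "V \<in> elts (DD (gis G))" "u = ck_class V" using u by (rule elts_CK_E)
    then have "\<forall>X\<in>F. dense_below (ideal_rel G X) (ideal_rel G V)"
      using le F(3) ck_class_le_iff by blast
    then show "nat_le (CK G) (ck_class (\<Union>F)) u"
      using V U by (simp add: ck_class_le_iff dense_below_Union)
  qed
qed

text \<open>Boundedness implies compatibility. Two pairs sharing a coordinate are moved into V by
  one common word, by extending one pair, then the other, and carrying the words across; there the
  remaining coordinates agree, and the word cancels.\<close>

lemma dense_below_partial_bij:
  assumes F: "F \<subseteq> elts (DD (gis G))" and V: "V \<in> elts (DD (gis G))"
    and d: "\<And>X. X \<in> F \<Longrightarrow> dense_below (ideal_rel G X) (ideal_rel G V)"
  shows "partial_bij (\<Union>(ideal_rel G ` F))"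
proof -
  have pb: "partial_bij (ideal_rel G V)" using V by (rule DD.rep_partial_bij)
  have common: "\<exists>z. (ext a z, ext b z) \<in> ideal_rel G V \<and> (ext c z, ext d z) \<in> ideal_rel G V"
    if X: "X \<in> F" "(a, b) \<in> ideal_rel G X" and Y: "Y \<in> F" "(c, d) \<in> ideal_rel G Y" and "a = c \<or> b = d"
    for X Y a b c d
  proof -
    have XY: "X \<in> elts (DD (gis G))" "Y \<in> elts (DD (gis G))" using X Y F by auto
    obtain z where z: "(ext a z, ext b z) \<in> ideal_rel G V"
      using d X unfolding dense_below_def by blast
    then have "(ext a z, ext b z) \<in> path_pairs G" using ideal_rel_path_pairs[OF V] by blast
    then have "(path_dom G c, z) \<in> paths G \<or> (path_dom G d, z) \<in> paths G"
      using \<open>a = c \<or> b = d\<close> by (auto simp: ext_pair_iff)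
    then have "(ext c z, ext d z) \<in> ideal_rel G Y" by (rule ideal_rel_ext[OF XY(2) Y(2)])
    then obtain w where w: "(ext c (z @ w), ext d (z @ w)) \<in> ideal_rel G V"
      using d[OF Y(1)] unfolding dense_below_def by (metis ext_ext)
    then have "(ext c (z @ w), ext d (z @ w)) \<in> path_pairs G" using ideal_rel_path_pairs[OF V] by blast
    then have "(path_dom G (ext a z), w) \<in> paths G \<or> (path_dom G (ext b z), w) \<in> paths G"
      using \<open>a = c \<or> b = d\<close> by (auto simp: ext_pair_iff paths_append)
    then have "(ext a (z @ w), ext b (z @ w)) \<in> ideal_rel G V" using ideal_rel_ext[OF V z] by simp
    then show ?thesis using w by blast
  qed
  show ?thesis
  proof (rule partial_bijI)
    fix a b c assume "(a, b) \<in> \<Union>(ideal_rel G ` F)" "(a, c) \<in> \<Union>(ideal_rel G ` F)"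
    then obtain z where "(ext a z, ext b z) \<in> ideal_rel G V" "(ext a z, ext c z) \<in> ideal_rel G V"
      using common by blast
    then have "ext b z = ext c z" by (rule partial_bijD1[OF pb])
    then show "b = c" by simp
  next
    fix a b c assume "(a, c) \<in> \<Union>(ideal_rel G ` F)" "(b, c) \<in> \<Union>(ideal_rel G ` F)"
    then obtain z where "(ext a z, ext c z) \<in> ideal_rel G V" "(ext b z, ext c z) \<in> ideal_rel G V"
      using common by blast
    then have "ext a z = ext b z" by (rule partial_bijD2[OF pb])
    then show "a = b" by simp
  qed
qed

text \<open>The distributive laws assume a join but no compatibility. The join is an upper bound, so
  the representatives can be united, and uniqueness of joins identifies j with the class of their
  union.\<close>

lemma CK_join_E:
  assumes A: "finite A" "A \<noteq> {}" "A \<subseteq> elts (CK G)" and j: "is_join (CK G) A j"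
  obtains F where "finite F" "F \<noteq> {}" "F \<subseteq> elts (DD (gis G))" "partial_bij (\<Union>(ideal_rel G ` F))"
    "A = ck_class ` F" "j = ck_class (\<Union>F)"
proof -
  obtain F where F: "F \<subseteq> elts (DD (gis G))" "finite F" "A = ck_class ` F"
    using A by (metis elts_CK finite_subset_image)
  then have ne: "F \<noteq> {}" using A(2) by blast
  obtain V where V: "V \<in> elts (DD (gis G))" "j = ck_class V"
    using j by (meson elts_CK_E is_join_def)
  have "dense_below (ideal_rel G X) (ideal_rel G V)" if "X \<in> F" for X
    using that j F V by (auto simp: is_join_def simp flip: ck_class_le_iff)
  then have pb: "partial_bij (\<Union>(ideal_rel G ` F))"
    using dense_below_partial_bij F(1) V(1) by blast
  have "j = ck_class (\<Union>F)"
    using CK.is_join_unique[OF j] ck_class_Union_join[OF F(2) ne F(1) pb] F(3) by blast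
  then show thesis using that F ne pb by blast
qed

text \<open>With joins realized as unions of ideals, both distributive laws say that multiplication
  of subsets commutes with unions.\<close>

sublocale CK: distributive_inverse_semigroup "CK G"
proof
  show "\<exists>j. is_join (CK G) A j" if A: "finite A" "A \<noteq> {}" "compatible_set (CK G) A" for A
  proof -
    have "A \<subseteq> ck_class ` elts (DD (gis G))"
      using A(3) by (simp add: compatible_set_def elts_CK)
    then obtain F where F: "F \<subseteq> elts (DD (gis G))" "finite F" "A = ck_class ` F"
      using finite_subset_image[OF A(1)] by blast
    have "F \<noteq> {}" using A(2) F(3) by simp
    moreover have "partial_bij (\<Union>(ideal_rel G ` F))"
      using A(3) ck_class_compatible_set_iff[OF F(1)] F(3) by simp
    ultimately show ?thesis using ck_class_Union_join[OF F(2) _ F(1)] F(3) by auto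
  qed
next
  fix A j s assume A: "finite A" "A \<noteq> {}" "A \<subseteq> elts (CK G)" "is_join (CK G) A j" and s: "s \<in> elts (CK G)"
  obtain F where F: "finite F" "F \<noteq> {}" "F \<subseteq> elts (DD (gis G))" "partial_bij (\<Union>(ideal_rel G ` F))"
    "A = ck_class ` F" "j = ck_class (\<Union>F)"
    by (rule CK_join_E[OF A])
  note U = Union_DD[OF F(1-4)]
  obtain Z where Z: "Z \<in> elts (DD (gis G))" "s = ck_class Z" using s by (rule elts_CK_E)
  have pbZ: "partial_bij (ideal_rel G Z)" using Z(1) by (rule DD.rep_partial_bij)
  show "is_join (CK G) ((\<lambda>a. s \<odot>\<^bsub>CK G\<^esub> a) ` A) (s \<odot>\<^bsub>CK G\<^esub> j)"
  proof -
    let ?F = "(\<lambda>X. Z \<odot>\<^bsub>DD (gis G)\<^esub> X) ` F"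
    have F': "finite ?F" "?F \<noteq> {}" "?F \<subseteq> elts (DD (gis G))"
      using F(1-3) Z(1) DD.rep_closed by auto
    have "\<Union>(ideal_rel G ` ?F) = ideal_rel G Z O \<Union>(ideal_rel G ` F)"
      using F(3) Z(1) by (auto simp: DD.rep_times subset_iff)
    then have "partial_bij (\<Union>(ideal_rel G ` ?F))"
      using partial_bij_relcomp[OF pbZ F(4)] by simp
    from ck_class_Union_join[OF F' this]
    have "is_join (CK G) (ck_class ` ?F) (ck_class (\<Union>?F))" .
    moreover have "\<Union>?F = Z \<odot>\<^bsub>DD (gis G)\<^esub> \<Union>F" by (auto simp: DD_times)
    moreover have "ck_class ` ?F = (\<lambda>a. s \<odot>\<^bsub>CK G\<^esub> a) ` A"
      unfolding F(5) Z(2) image_image using F(3) Z(1) by (intro image_cong) (auto simp: ck_class_times)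
    ultimately show ?thesis using U(1) Z F(6) by (simp add: ck_class_times)
  qed
  show "is_join (CK G) ((\<lambda>a. a \<odot>\<^bsub>CK G\<^esub> s) ` A) (j \<odot>\<^bsub>CK G\<^esub> s)"
  proof -
    let ?F = "(\<lambda>X. X \<odot>\<^bsub>DD (gis G)\<^esub> Z) ` F"
    have F': "finite ?F" "?F \<noteq> {}" "?F \<subseteq> elts (DD (gis G))"
      using F(1-3) Z(1) DD.rep_closed by auto
    have "\<Union>(ideal_rel G ` ?F) = \<Union>(ideal_rel G ` F) O ideal_rel G Z"
      using F(3) Z(1) by (auto simp: DD.rep_times subset_iff)
    then have "partial_bij (\<Union>(ideal_rel G ` ?F))"
      using partial_bij_relcomp[OF F(4) pbZ] by simp
    from ck_class_Union_join[OF F' this]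
    have "is_join (CK G) (ck_class ` ?F) (ck_class (\<Union>?F))" .
    moreover have "\<Union>?F = \<Union>F \<odot>\<^bsub>DD (gis G)\<^esub> Z" by (auto simp: DD_times)
    moreover have "ck_class ` ?F = (\<lambda>a. a \<odot>\<^bsub>CK G\<^esub> s) ` A"
      unfolding F(5) Z(2) image_image using F(3) Z(1) by (intro image_cong) (auto simp: ck_class_times)
    ultimately show ?thesis using U(1) Z F(6) by (simp add: ck_class_times)
  qed
qed

section \<open>The canonical map and generation by its image\<close>

lemma homomorphism_ck_map: "homomorphism (gis G) (CK G) (ck_map G)"
proof -
  have "down (gis G) {s} \<odot>\<^bsub>DD (gis G)\<^esub> down (gis G) {t} = down (gis G) {gis_times G s t}"
    if "s \<in> elts (gis G)" "t \<in> elts (gis G)" for s t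
    using that DD_times_down[of "{s}" "{t}"] by simp
  then show ?thesis
    by (simp add: homomorphism_def Pi_iff ck_map_eq ck_class_closed DD_principal ck_class_times)
qed

lemma ck_class_join:
  assumes A: "finite A" "A \<noteq> {}" "compatible_set (gis G) A"
  shows "is_join (CK G) (ck_map G ` A) (ck_class (down (gis G) A))"
proof -
  let ?F = "(\<lambda>s. down (gis G) {s}) ` A"
  have sub: "A \<subseteq> elts (gis G)" using A by (simp add: compatible_set_def)
  then have F: "finite ?F" "?F \<noteq> {}" "?F \<subseteq> elts (DD (gis G))" using A DD_principal by auto
  have "\<Union>(ideal_rel G ` ?F) = \<Union>(gis_rel G ` A)"
    using sub ideal_rel_principal by (auto simp: subset_iff)
  then have "partial_bij (\<Union>(ideal_rel G ` ?F))" using A(3) gis.compatible_set_iff by simp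
  from ck_class_Union_join[OF F this]
  have "is_join (CK G) (ck_class ` ?F) (ck_class (\<Union>?F))" .
  moreover have "\<Union>?F = down (gis G) A" by (auto simp: down_def)
  moreover have "ck_class ` ?F = ck_map G ` A" by (simp add: image_image ck_map_eq)
  ultimately show ?thesis by simp
qed

end


section \<open>The Cuntz-Krieger relations and injectivity\<close>

abbreviation path_idem :: "'v \<Rightarrow> 'e list \<Rightarrow> ('v, 'e) gis_elt" where
  "path_idem v xs \<equiv> Frac (v, xs) (v, xs)"

lemma ext_vertex: "ext (v, []) z = (v, z)"
  by (simp add: ext_def)

lemma ext_pair: "ext (v, xs) z = (v, xs @ z)"
  by (simp add: ext_def)

context wf_digraph
begin

section \<open>Idempotents of the graph inverse semigroup and the elements they cover\<close>

lemma path_idem_closed: "path_idem v xs \<in> elts (gis G) \<longleftrightarrow> (v, xs) \<in> paths G"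
  by (simp add: path_pairs_def)

lemma path_idem_idempotent: "(v, xs) \<in> paths G \<Longrightarrow> path_idem v xs \<in> idempotents (gis G)"
  unfolding gis.idempotents_iff path_idem_closed by (auto simp: ext_pair)

lemma idempotents_gis_E:
  assumes "e \<in> idempotents (gis G)"
  obtains "e = Zero" | v xs where "(v, xs) \<in> paths G" "e = path_idem v xs"
proof (cases "e = Zero")
  case False
  have e: "e \<in> elts (gis G)" "gis_rel G e \<subseteq> Id" using assms by (simp_all add: gis.idempotents_iff)
  then obtain a b where ab: "e = Frac a b" "(a, b) \<in> path_pairs G"
    using False by (meson Frac_exhaust_nonzero)
  then have "a = b" using e(2) gis_rel_refl by blast
  moreover obtain v xs where "a = (v, xs)" by (cases a)
  ultimately have "e = path_idem v xs" using ab(1) by simp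
  moreover from this have "(v, xs) \<in> paths G" using e(1) path_idem_closed by simp
  ultimately show thesis by (rule that(2)[rotated])
qed (rule that(1))

lemma path_idem_le_iff:
  assumes "(v, xs) \<in> paths G" "(w, ys) \<in> paths G"
  shows "nat_le (gis G) (path_idem v xs) (path_idem w ys) \<longleftrightarrow> v = w \<and> (\<exists>z. xs = ys @ z)"
proof -
  have pp: "((v, xs), (v, xs)) \<in> path_pairs G" using assms by (simp add: path_pairs_def)
  have "nat_le (gis G) (path_idem v xs) (path_idem w ys) \<longleftrightarrow> ((v, xs), (v, xs)) \<in> gis_rel G (path_idem w ys)"
    unfolding gis.nat_le_iff path_idem_closed gis_rel_Frac_subset_iff[OF pp] using assms by blast
  also have "\<dots> \<longleftrightarrow> v = w \<and> (\<exists>z. xs = ys @ z)"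
    using assms by (auto simp: ext_pair paths_append)
  finally show ?thesis .
qed

lemma Zero_less_iff: "nat_less (gis G) Zero s \<longleftrightarrow> s \<in> elts (gis G) \<and> s \<noteq> Zero"
  by (auto simp: nat_less_def gis.nat_le_iff)

lemma not_less_Zero: "\<not> nat_less (gis G) s Zero"
  using gis.eq_szero_iff by (auto simp: nat_less_def gis.nat_le_iff)

lemma arc_path: "f \<in> in_arcs G v \<Longrightarrow> (v, [f]) \<in> paths G"
  by (auto simp: tail_in_verts)

text \<open>An incoming edge yields an idempotent strictly between zero and the vertex, so zero is
  not covered. Every other idempotent strictly below the vertex belongs to a nonempty path and lies
  below that of its first edge.\<close>

lemma covered_by_vertex:
  assumes v: "v \<in> verts G" and ne: "in_arcs G v \<noteq> {}"
  shows "covered_by (gis G) (path_idem v []) = (\<lambda>f. path_idem v [f]) ` in_arcs G v"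
proof (intro equalityI subsetI)
  fix g assume "g \<in> covered_by (gis G) (path_idem v [])"
  then have g: "g \<in> idempotents (gis G)" "nat_less (gis G) g (path_idem v [])"
    and no: "\<And>h. \<lbrakk>h \<in> idempotents (gis G); nat_less (gis G) g h\<rbrakk> \<Longrightarrow> \<not> nat_less (gis G) h (path_idem v [])"
    by (auto simp: covered_by_def)
  have arc_less: "nat_less (gis G) (path_idem v [f]) (path_idem v [])" if "f \<in> in_arcs G v" for f
    using v arc_path[OF that] path_idem_le_iff by (simp add: nat_less_def del: paths_Cons)
  show "g \<in> (\<lambda>f. path_idem v [f]) ` in_arcs G v"
    using g(1)
  proof (cases rule: idempotents_gis_E)
    case 1
    obtain f where f: "f \<in> in_arcs G v" using ne by blast
    have "path_idem v [f] \<in> elts (gis G)" using arc_path[OF f] path_idem_closed by blast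
    then have "nat_less (gis G) g (path_idem v [f])" unfolding 1 Zero_less_iff by simp
    then show ?thesis using no path_idem_idempotent[OF arc_path[OF f]] arc_less[OF f] by blast
  next
    case (2 w xs)
    then have "w = v" "xs \<noteq> []" using g(2) path_idem_le_iff[OF 2(1), of v "[]"] v by (auto simp: nat_less_def)
    then obtain f r where xs: "xs = f # r" by (cases xs) auto
    have f: "f \<in> in_arcs G v" using 2(1) \<open>w = v\<close> xs by simp
    have "nat_le (gis G) g (path_idem v [f])"
      using 2 path_idem_le_iff[OF 2(1) arc_path[OF f]] \<open>w = v\<close> xs by simp
    moreover have "\<not> nat_less (gis G) g (path_idem v [f])"
      using no path_idem_idempotent[OF arc_path[OF f]] arc_less[OF f] by blast
    ultimately show ?thesis using f by (auto simp: nat_less_def)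
  qed
next
  fix g assume "g \<in> (\<lambda>f. path_idem v [f]) ` in_arcs G v"
  then obtain f where f: "f \<in> in_arcs G v" "g = path_idem v [f]" by blast
  have p: "(v, [f]) \<in> paths G" "(v, []) \<in> paths G" using f arc_path v by auto
  have "nat_less (gis G) g (path_idem v [])"
    unfolding f(2) nat_less_def path_idem_le_iff[OF p] by simp
  moreover have "\<not> nat_less (gis G) h (path_idem v [])"
    if h: "h \<in> idempotents (gis G)" "nat_less (gis G) g h" for h
    using h(1)
  proof (cases rule: idempotents_gis_E)
    case 1
    then show ?thesis using h(2) not_less_Zero by blast
  next
    case (2 w xs)
    then have "w = v" "\<exists>z. [f] = xs @ z" "xs \<noteq> [f]"
      using h(2) path_idem_le_iff[OF p(1) 2(1)] f(2) by (auto simp: nat_less_def)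
    then have "xs = []" by (cases xs) auto
    then show ?thesis using 2 \<open>w = v\<close> by (simp add: nat_less_def)
  qed
  ultimately show "g \<in> covered_by (gis G) (path_idem v [])"
    using path_idem_idempotent[OF p(1)] f(2) by (auto simp: covered_by_def)
qed

lemma vertex_in_ck_idempotents:
  assumes v: "v \<in> verts G" and ne: "in_arcs G v \<noteq> {}"
  shows "path_idem v [] \<in> ck_idempotents (gis G)"
proof -
  have p: "(v, []) \<in> paths G" using v by simp
  have "\<not> nat_less (gis G) (path_idem v []) f" if "f \<in> idempotents (gis G)" for f
    using that
  proof (cases rule: idempotents_gis_E)
    case 1
    then show ?thesis using not_less_Zero by blast
  next
    case (2 w xs)
    then show ?thesis using path_idem_le_iff[OF p 2(1)] by (auto simp: nat_less_def)
  qed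
  then have "path_idem v [] \<in> maximal_idempotents (gis G)"
    using path_idem_idempotent[OF p] by (auto simp: maximal_idempotents_def)
  then show ?thesis using ne by (auto simp: ck_idempotents_def covered_by_vertex[OF v ne])
qed

text \<open>Maximality forces the empty path at v. The nonzero covered element then belongs to a
  nonempty path with range v, whose first edge is an incoming one.\<close>

lemma ck_idempotents_E:
  assumes "e \<in> ck_idempotents (gis G)"
  obtains v where "v \<in> verts G" "in_arcs G v \<noteq> {}" "e = path_idem v []"
proof -
  obtain f where e: "e \<in> idempotents (gis G)" "\<And>g. g \<in> idempotents (gis G) \<Longrightarrow> \<not> nat_less (gis G) e g"
    and f: "f \<in> idempotents (gis G)" "nat_less (gis G) f e" "f \<noteq> Zero"
    using assms by (auto simp: ck_idempotents_def maximal_idempotents_def covered_by_def)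
  have "e \<noteq> Zero" using f(2) not_less_Zero by blast
  with e(1) obtain v xs where vxs: "(v, xs) \<in> paths G" "e = path_idem v xs"
    by (meson idempotents_gis_E)
  have v: "v \<in> verts G" using vxs(1) path_head_in_verts by blast
  then have pv: "(v, []) \<in> paths G" by simp
  have "nat_le (gis G) e (path_idem v [])"
    using vxs(2) path_idem_le_iff[OF vxs(1) pv] by simp
  then have ev: "e = path_idem v []"
    using e(2)[OF path_idem_idempotent[OF pv]] by (auto simp: nat_less_def)
  obtain w ys where wys: "(w, ys) \<in> paths G" "f = path_idem w ys"
    using f(1,3) by (meson idempotents_gis_E)
  then have "w = v" "ys \<noteq> []"
    using f(2) path_idem_le_iff[OF wys(1) pv] ev by (auto simp: nat_less_def)
  then have "in_arcs G v \<noteq> {}" using wys(1) by (cases ys) auto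
  then show thesis using that v ev by blast
qed

section \<open>Classes of single elements: Cuntz-Krieger relations and injectivity\<close>

lemma ck_map_closed: "s \<in> elts (gis G) \<Longrightarrow> ck_map G s \<in> elts (CK G)"
  by (simp add: ck_map_eq ck_class_closed DD_principal)

lemma ck_map_eq_iff:
  assumes "s \<in> elts (gis G)" "t \<in> elts (gis G)"
  shows "ck_map G s = ck_map G t \<longleftrightarrow>
    dense_below (gis_rel G s) (gis_rel G t) \<and> dense_below (gis_rel G t) (gis_rel G s)"
  using assms by (simp add: ck_map_eq ck_class_eq_iff DD_principal ideal_rel_principal)

text \<open>A nonempty path at v already lies below the idempotent of its first edge, and the empty
  path can be prolonged by some incoming edge. So the incoming edges together are dense below the
  vertex.\<close>

lemma dense_below_vertex:
  assumes ne: "in_arcs G v \<noteq> {}"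
    and d: "\<And>f. f \<in> in_arcs G v \<Longrightarrow> dense_below (gis_rel G (path_idem v [f])) R"
  shows "dense_below (gis_rel G (path_idem v [])) R"
  unfolding dense_below_def
proof (intro allI impI)
  fix a b assume "(a, b) \<in> gis_rel G (path_idem v [])"
  then obtain z where z: "a = (v, z)" "b = (v, z)" "(v, z) \<in> paths G" by (auto simp: ext_vertex)
  obtain f z' where f: "f \<in> in_arcs G v" and z': "(v, z @ z') \<in> paths G" "\<exists>r. z @ z' = [f] @ r"
  proof (cases z)
    case Nil
    obtain f where "f \<in> in_arcs G v" using ne by blast
    then show thesis using that[of f "[f]"] Nil arc_path by simp
  next
    case (Cons f r)
    then show thesis using that[of f "[]"] z(3) by simp
  qed
  from z'(2) obtain r where r: "z @ z' = [f] @ r" ..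
  then have "(tail G f, r) \<in> paths G" using z'(1) by simp
  then have "((v, z @ z'), (v, z @ z')) \<in> gis_rel G (path_idem v [f])"
    unfolding r by (auto simp: ext_pair)
  then obtain w where "(ext (v, z @ z') w, ext (v, z @ z') w) \<in> R"
    using d[OF f] unfolding dense_below_def by blast
  then have "(ext a (z' @ w), ext b (z' @ w)) \<in> R" by (simp add: z ext_pair)
  then show "\<exists>z. (ext a z, ext b z) \<in> R" by blast
qed

lemma ck_map_cuntz_krieger:
  assumes "e \<in> ck_idempotents (gis G)"
  shows "is_join (CK G) (ck_map G ` covered_by (gis G) e) (ck_map G e)"
proof -
  obtain v where v: "v \<in> verts G" "in_arcs G v \<noteq> {}" and e: "e = path_idem v []"
    using assms by (rule ck_idempotents_E)
  have p: "(v, []) \<in> paths G" using v by simp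
  show ?thesis
    unfolding is_join_def e covered_by_vertex[OF v]
  proof (intro conjI ballI impI)
    show "ck_map G (path_idem v []) \<in> elts (CK G)"
      using p path_idem_closed ck_map_closed by blast
    fix a assume "a \<in> ck_map G ` (\<lambda>f. path_idem v [f]) ` in_arcs G v"
    then obtain f where f: "f \<in> in_arcs G v" "a = ck_map G (path_idem v [f])" by blast
    show "nat_le (CK G) a (ck_map G (path_idem v []))"
      unfolding f(2) using path_idem_le_iff[OF arc_path[OF f(1)] p]
      by (intro homomorphism_nat_le[OF homomorphism_ck_map]) simp
  next
    fix u assume u: "u \<in> elts (CK G)"
      and le: "\<forall>a\<in>ck_map G ` (\<lambda>f. path_idem v [f]) ` in_arcs G v. nat_le (CK G) a u"
    obtain V where V: "V \<in> elts (DD (gis G))" "u = ck_class V" using u by (rule elts_CK_E)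
    have le_iff: "nat_le (CK G) (ck_map G s) u \<longleftrightarrow> dense_below (gis_rel G s) (ideal_rel G V)"
      if "s \<in> elts (gis G)" for s
      using that V by (simp add: ck_map_eq ck_class_le_iff DD_principal ideal_rel_principal)
    have "dense_below (gis_rel G (path_idem v [f])) (ideal_rel G V)" if f: "f \<in> in_arcs G v" for f
    proof -
      have "path_idem v [f] \<in> elts (gis G)" using arc_path[OF f] path_idem_closed by blast
      then show ?thesis using le_iff le f by blast
    qed
    then have "dense_below (gis_rel G (path_idem v [])) (ideal_rel G V)"
      by (rule dense_below_vertex[OF v(2)])
    moreover have "path_idem v [] \<in> elts (gis G)" using p path_idem_closed by blast
    ultimately show "nat_le (CK G) (ck_map G (path_idem v [])) u" using le_iff by blast
  qed
qed

text \<open>Suppose t extends s by a word beginning with f. A second incoming edge g at the same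
  vertex gives an extension of s that shares no further extension with t, contrary to
  density.\<close>

lemma dense_below_imp_eq:
  assumes fin: "\<forall>v\<in>verts G. finite (in_arcs G v)"
    and deg: "\<forall>v\<in>verts G. in_degree G v = 0 \<or> in_degree G v \<ge> 2"
    and s: "s \<in> elts (gis G)" and t: "t \<in> elts (gis G)"
    and sub: "gis_rel G t \<subseteq> gis_rel G s" and d: "dense_below (gis_rel G s) (gis_rel G t)"
  shows "s = t"
proof (cases "t = Zero")
  case True
  then show ?thesis using d s gis.eq_szero_iff by (simp add: dense_below_empty_iff)
next
  case False
  then obtain u v where t': "t = Frac u v" "(u, v) \<in> path_pairs G"
    using t by (meson Frac_exhaust_nonzero)
  then have uv: "(u, v) \<in> gis_rel G s" using sub gis_rel_refl by blast
  then have "s \<noteq> Zero" by auto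
  then obtain x y where s': "s = Frac x y" "(x, y) \<in> path_pairs G"
    using s by (meson Frac_exhaust_nonzero)
  obtain z where z: "u = ext x z" "v = ext y z" "(path_dom G x, z) \<in> paths G"
    using uv s' by auto
  show ?thesis
  proof (cases z)
    case Nil
    then show ?thesis using s' t' z by simp
  next
    case (Cons f r)
    let ?w = "path_dom G x"
    have w: "?w \<in> verts G" using path_head_in_verts[OF z(3)] .
    have f: "f \<in> in_arcs G ?w" using z(3) Cons by simp
    \<comment> \<open>Finiteness matters here: an infinite set has \<open>card\<close> 0 and would
      pass for in-degree 0.\<close>
    have "card (in_arcs G ?w) \<noteq> 0" using fin w f by auto
    then have "card (in_arcs G ?w) \<ge> 2" using bspec[OF deg w] by (simp add: in_degree_def)
    then have "\<not> in_arcs G ?w \<subseteq> {f}" using card_mono[of "{f}" "in_arcs G ?w"] by auto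
    then obtain g where g: "g \<in> in_arcs G ?w" "g \<noteq> f" by blast
    then have "(ext x [g], ext y [g]) \<in> gis_rel G s" using arc_path s' by auto
    then obtain q where "(ext x (g # q), ext y (g # q)) \<in> gis_rel G t"
      using d unfolding dense_below_def by fastforce
    then have "\<exists>q'. ext x (g # q) = ext x (z @ q')" unfolding t'(1) z by auto
    then show ?thesis using g(2) Cons by simp
  qed
qed

text \<open>A single incoming edge f at v makes the idempotents of v and of f dense in one another,
  so their classes coincide. Conversely, nonzero elements with equal classes overlap, hence are
  comparable, and \<open>dense_below_imp_eq\<close> applies.\<close>

lemma inj_on_ck_map_iff:
  assumes fin: "\<forall>v\<in>verts G. finite (in_arcs G v)"
  shows "inj_on (ck_map G) (elts (gis G)) \<longleftrightarrow> (\<forall>v\<in>verts G. in_degree G v = 0 \<or> in_degree G v \<ge> 2)"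
proof
  assume inj: "inj_on (ck_map G) (elts (gis G))"
  show "\<forall>v\<in>verts G. in_degree G v = 0 \<or> in_degree G v \<ge> 2"
  proof (rule ballI, rule ccontr)
    fix v assume v: "v \<in> verts G" and "\<not> (in_degree G v = 0 \<or> in_degree G v \<ge> 2)"
    then have "card (in_arcs G v) = 1" unfolding in_degree_def by linarith
    then obtain f where f: "in_arcs G v = {f}" by (meson card_1_singletonE)
    have p: "(v, []) \<in> paths G" "(v, [f]) \<in> paths G" using v arc_path[of f v] f by simp_all
    have cl: "path_idem v [] \<in> elts (gis G)" "path_idem v [f] \<in> elts (gis G)"
      using p path_idem_closed by blast+
    have "dense_below (gis_rel G (path_idem v [])) (gis_rel G (path_idem v [f]))"
      by (rule dense_below_vertex) (simp_all add: f subset_dense_below del: gis_rel.simps)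
    moreover have "nat_le (gis G) (path_idem v [f]) (path_idem v [])"
      using path_idem_le_iff[OF p(2,1)] by simp
    then have "dense_below (gis_rel G (path_idem v [f])) (gis_rel G (path_idem v []))"
      unfolding gis.nat_le_iff by (intro subset_dense_below) blast
    ultimately have "ck_map G (path_idem v []) = ck_map G (path_idem v [f])"
      using ck_map_eq_iff[OF cl] by blast
    then have "path_idem v [] = path_idem v [f]" by (rule inj_onD[OF inj _ cl])
    then show False by simp
  qed
next
  assume deg: "\<forall>v\<in>verts G. in_degree G v = 0 \<or> in_degree G v \<ge> 2"
  show "inj_on (ck_map G) (elts (gis G))"
  proof (rule inj_onI)
    fix s t assume s: "s \<in> elts (gis G)" and t: "t \<in> elts (gis G)" and "ck_map G s = ck_map G t"
    then have d: "dense_below (gis_rel G s) (gis_rel G t)" "dense_below (gis_rel G t) (gis_rel G s)"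
      using ck_map_eq_iff by blast+
    show "s = t"
    proof (cases "gis_rel G s \<inter> gis_rel G t = {}")
      case False
      then have "gis_rel G s \<subseteq> gis_rel G t \<or> gis_rel G t \<subseteq> gis_rel G s"
        using gis_rel_overlap s t by blast
      then show ?thesis
        using dense_below_imp_eq[OF fin deg s t] dense_below_imp_eq[OF fin deg t s] d by auto
    next
      case True
      have "gis_rel G s = {}"
      proof (rule equals0I)
        fix c assume "c \<in> gis_rel G s"
        then obtain x y where s': "s = Frac x y" by (cases s) auto
        then have "(x, y) \<in> path_pairs G" using s by simp
        then have "(x, y) \<in> gis_rel G s" using s' gis_rel_refl by blast
        then obtain z where z: "(ext x z, ext y z) \<in> gis_rel G t"
          using d(1) unfolding dense_below_def by blast
        then have "(ext x z, ext y z) \<in> path_pairs G" using gis_rel_path_pairs[OF t] by blast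
        then have "(path_dom G x, z) \<in> paths G" by (simp add: ext_pair_iff)
        then have "(ext x z, ext y z) \<in> gis_rel G s" unfolding s' gis_rel.simps by blast
        then show False using z True by blast
      qed
      then show ?thesis using d(2) s t gis.rep_eq_iff by (simp add: dense_below_empty_iff)
    qed
  qed
qed

end


section \<open>The universal property\<close>

locale ck_representation = wf_digraph G + T: distributive_inverse_semigroup T
  for G :: "('v, 'e) pre_digraph" and T :: "('t, 'm) semigrp_scheme" +
  fixes \<theta> :: "('v, 'e) gis_elt \<Rightarrow> 't"
  assumes hom: "homomorphism (gis G) T \<theta>"
    and ck_join: "e \<in> ck_idempotents (gis G) \<Longrightarrow> is_join T (\<theta> ` covered_by (gis G) e) (\<theta> e)"
    and finite_in_arcs: "v \<in> verts G \<Longrightarrow> finite (in_arcs G v)"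
begin

section \<open>Joins of the values of \<open>\<theta>\<close> over ideals\<close>

lemma theta_join_down_iff:
  assumes "A \<subseteq> elts (gis G)"
  shows "is_join T (\<theta> ` down (gis G) A) j \<longleftrightarrow> is_join T (\<theta> ` A) j"
proof (rule T.is_join_cong)
  fix u assume "u \<in> elts T"
  have "A \<subseteq> down (gis G) A" using assms gis.nat_le_refl by (auto simp: down_def)
  moreover have "nat_le T (\<theta> s) u" if "\<forall>a\<in>\<theta> ` A. nat_le T a u" "s \<in> down (gis G) A" for s
    using that homomorphism_nat_le[OF hom] T.nat_le_trans unfolding down_def by blast
  ultimately show "(\<forall>a\<in>\<theta> ` down (gis G) A. nat_le T a u) \<longleftrightarrow> (\<forall>a\<in>\<theta> ` A. nat_le T a u)"
    by blast
qed

text \<open>The join ranges over the whole ideal, so its value depends on X alone. Existence in T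
  comes from finite generating sets, which have the same upper bounds under the monotone map
  \<open>\<theta>\<close>.\<close>

definition ideal_join :: "('v, 'e) gis_elt set \<Rightarrow> 't" where
  "ideal_join X = (THE j. is_join T (\<theta> ` X) j)"

lemma ideal_join_eqI: "is_join T (\<theta> ` X) j \<Longrightarrow> ideal_join X = j"
  unfolding ideal_join_def using T.is_join_unique by blast

lemma ideal_join_down:
  assumes "finite A" "A \<noteq> {}" "compatible_set (gis G) A"
  shows "is_join T (\<theta> ` A) (ideal_join (down (gis G) A))"
proof -
  have "compatible_set T (\<theta> ` A)"
    using T.homomorphism_compatible_set[OF hom] gis.inverse_semigroup_axioms assms(3) by blast
  then obtain j where "is_join T (\<theta> ` A) j" using T.join_ex assms(1,2) by blast
  moreover have "A \<subseteq> elts (gis G)" using assms(3) by (simp add: compatible_set_def)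
  ultimately show ?thesis using ideal_join_eqI theta_join_down_iff by metis
qed

lemma ideal_join:
  assumes "X \<in> elts (DD (gis G))"
  shows "is_join T (\<theta> ` X) (ideal_join X)"
proof -
  obtain A where "finite A" "A \<noteq> {}" "A \<subseteq> elts (gis G)" "X = down (gis G) A" "compatible_set (gis G) A"
    using assms by (rule DD_E)
  then show ?thesis using ideal_join_down theta_join_down_iff by simp
qed

lemma ideal_join_closed: "X \<in> elts (DD (gis G)) \<Longrightarrow> ideal_join X \<in> elts T"
  using ideal_join by (simp add: is_join_def)

lemma theta_le_ideal_join: "\<lbrakk>X \<in> elts (DD (gis G)); s \<in> X\<rbrakk> \<Longrightarrow> nat_le T (\<theta> s) (ideal_join X)"
  using ideal_join by (auto simp: is_join_def)

text \<open>Only finite joins are known to distribute in T, so the product is computed on finite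
  generating sets and then carried back to the ideals.\<close>

lemma ideal_join_times:
  assumes X: "X \<in> elts (DD (gis G))" and Y: "Y \<in> elts (DD (gis G))"
  shows "ideal_join (X \<odot>\<^bsub>DD (gis G)\<^esub> Y) = ideal_join X \<odot>\<^bsub>T\<^esub> ideal_join Y"
proof (rule ideal_join_eqI)
  obtain A where A: "finite A" "A \<noteq> {}" "A \<subseteq> elts (gis G)" "X = down (gis G) A" "compatible_set (gis G) A"
    using X by (rule DD_E)
  obtain B where B: "finite B" "B \<noteq> {}" "B \<subseteq> elts (gis G)" "Y = down (gis G) B" "compatible_set (gis G) B"
    using Y by (rule DD_E)
  let ?C = "\<Union>a\<in>A. gis_times G a ` B"
  have C: "?C \<subseteq> elts (gis G)" using A(3) B(3) by (auto simp: gis_times_closed_and_rel subset_iff)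
  have XY: "X \<odot>\<^bsub>DD (gis G)\<^esub> Y = down (gis G) ?C" using DD_times_down A(3,4) B(3,4) by simp
  have img: "\<theta> ` A \<subseteq> elts T" "\<theta> ` B \<subseteq> elts T"
    using A(3) B(3) homomorphism_closed[OF hom] by auto
  have "\<theta> (gis_times G a b) = \<theta> a \<odot>\<^bsub>T\<^esub> \<theta> b" if "a \<in> A" "b \<in> B" for a b
    using homomorphism_times[OF hom, of a b] that A(3) B(3) by auto
  then have "\<theta> ` ?C = (\<Union>a\<in>\<theta> ` A. (\<lambda>b. a \<odot>\<^bsub>T\<^esub> b) ` \<theta> ` B)"
    by (simp add: image_UN image_image)
  moreover have "is_join T (\<Union>a\<in>\<theta> ` A. (\<lambda>b. a \<odot>\<^bsub>T\<^esub> b) ` \<theta> ` B) (ideal_join X \<odot>\<^bsub>T\<^esub> ideal_join Y)"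
    using A B img ideal_join_down
    by (intro distributive_join_times T.distributive_inverse_semigroup_axioms) auto
  ultimately show "is_join T (\<theta> ` (X \<odot>\<^bsub>DD (gis G)\<^esub> Y)) (ideal_join X \<odot>\<^bsub>T\<^esub> ideal_join Y)"
    unfolding XY theta_join_down_iff[OF C] by simp
qed

text \<open>Factoring through the common domain isolates the word w in an idempotent in the middle,
  which is where the relation at the vertex can be applied.\<close>

lemma gis_times_path_idem:
  assumes ab: "(a, b) \<in> path_pairs G" and w: "(path_dom G a, w) \<in> paths G"
  shows "gis_times G (gis_times G (Frac a (path_dom G a, [])) (path_idem (path_dom G a) w))
    (Frac (path_dom G a, []) b) = Frac (ext a w) (ext b w)"
proof -
  have "gis_times G (Frac a (path_dom G a, [])) (path_idem (path_dom G a) w) =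
      Frac (ext a w) (path_dom G a, w)"
    using gis_times_left[of "(path_dom G a, [])" w a "(path_dom G a, w)"] w
    by (simp add: ext_vertex del: ext_in_paths gis_times.simps)
  moreover have "gis_times G (Frac (ext a w) (path_dom G a, w)) (Frac (path_dom G a, []) b) =
      Frac (ext a w) (ext b w)"
    using gis_times_right[of "(path_dom G a, [])" w "ext a w" b] w
    by (simp add: ext_vertex del: ext_in_paths gis_times.simps)
  ultimately show ?thesis by simp
qed

text \<open>
  Multiply the relation at the common domain \<open>v\<close> by \<open>a1\<^sub>v\<^sup>-\<^sup>1\<close> on the left and \<open>1\<^sub>vb\<^sup>-\<^sup>1\<close> on the right.
\<close>

lemma theta_Frac_join:
  assumes ab: "(a, b) \<in> path_pairs G" and ne: "in_arcs G (path_dom G a) \<noteq> {}"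
  shows "is_join T ((\<lambda>f. \<theta> (Frac (ext a [f]) (ext b [f]))) ` in_arcs G (path_dom G a)) (\<theta> (Frac a b))"
proof -
  let ?v = "path_dom G a"
  let ?E = "in_arcs G ?v"
  have v: "?v \<in> verts G" using ab path_dom_in_verts by (simp add: path_pairs_def)
  have cl: "Frac a (?v, []) \<in> elts (gis G)" "Frac (?v, []) b \<in> elts (gis G)"
    using ab v by (simp_all add: path_pairs_def)
  have cl_idem: "path_idem ?v w \<in> elts (gis G)" if "(?v, w) \<in> paths G" for w
    using that path_idem_closed by blast
  have mult: "\<theta> (Frac a (?v, [])) \<odot>\<^bsub>T\<^esub> \<theta> (path_idem ?v w) \<odot>\<^bsub>T\<^esub> \<theta> (Frac (?v, []) b) =
      \<theta> (Frac (ext a w) (ext b w))" if w: "(?v, w) \<in> paths G" for w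
  proof -
    have "gis_times G (Frac a (?v, [])) (path_idem ?v w) \<in> elts (gis G)"
      using gis_times_closed_and_rel cl(1) cl_idem[OF w] by blast
    then show ?thesis
      using homomorphism_times[OF hom] cl cl_idem[OF w] gis_times_path_idem[OF ab w] by (metis gis_times_eq)
  qed
  have join: "is_join T ((\<lambda>f. \<theta> (path_idem ?v [f])) ` ?E) (\<theta> (path_idem ?v []))"
    using ck_join[OF vertex_in_ck_idempotents[OF v ne]] by (simp add: covered_by_vertex[OF v ne] image_image)
  \<comment> \<open>Finite in-degree enters here, because the distributive laws of T concern finite
    joins.\<close>
  have fin: "finite ((\<lambda>f. \<theta> (path_idem ?v [f])) ` ?E)" using finite_in_arcs[OF v] by simp
  have sub: "(\<lambda>f. \<theta> (path_idem ?v [f])) ` ?E \<subseteq> elts T"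
    using homomorphism_closed[OF hom] cl_idem arc_path by blast
  note thcl = homomorphism_closed[OF hom cl(1)] homomorphism_closed[OF hom cl(2)]
  have "is_join T ((\<lambda>t. \<theta> (Frac a (?v, [])) \<odot>\<^bsub>T\<^esub> t) ` (\<lambda>f. \<theta> (path_idem ?v [f])) ` ?E)
      (\<theta> (Frac a (?v, [])) \<odot>\<^bsub>T\<^esub> \<theta> (path_idem ?v []))"
    using T.join_distrib_left[OF fin _ sub join thcl(1)] ne by simp
  then have "is_join T ((\<lambda>t. t \<odot>\<^bsub>T\<^esub> \<theta> (Frac (?v, []) b)) `
      (\<lambda>t. \<theta> (Frac a (?v, [])) \<odot>\<^bsub>T\<^esub> t) ` (\<lambda>f. \<theta> (path_idem ?v [f])) ` ?E)
      (\<theta> (Frac a (?v, [])) \<odot>\<^bsub>T\<^esub> \<theta> (path_idem ?v []) \<odot>\<^bsub>T\<^esub> \<theta> (Frac (?v, []) b))"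
    using fin ne sub T.times_closed[OF thcl(1)] thcl(2)
    by (intro T.join_distrib_right) (auto simp: image_subset_iff)
  moreover have "\<theta> (Frac a (?v, [])) \<odot>\<^bsub>T\<^esub> \<theta> (path_idem ?v []) \<odot>\<^bsub>T\<^esub> \<theta> (Frac (?v, []) b) = \<theta> (Frac a b)"
    using mult[of "[]"] v by simp
  moreover have "(\<lambda>t. t \<odot>\<^bsub>T\<^esub> \<theta> (Frac (?v, []) b)) `
      (\<lambda>t. \<theta> (Frac a (?v, [])) \<odot>\<^bsub>T\<^esub> t) ` (\<lambda>f. \<theta> (path_idem ?v [f])) ` ?E =
      (\<lambda>f. \<theta> (Frac (ext a [f]) (ext b [f]))) ` ?E"
    unfolding image_image using mult arc_path by (intro image_cong) auto
  ultimately show ?thesis by simp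
qed

text \<open>
  Expand \<open>xy\<^sup>-\<^sup>1\<close> along paths until \<open>y\<close> is at least as long as the second
  components of all generators of \<open>Y\<close>; from then on having a nonzero lower bound in \<open>Y\<close> forces
  membership in \<open>Y\<close>.
\<close>

lemma theta_le_if_dense:
  assumes Y: "Y \<in> elts (DD (gis G))" and ab: "(a, b) \<in> path_pairs G"
    and dense: "\<And>w. (path_dom G a, w) \<in> paths G \<Longrightarrow> \<exists>z. (ext a (w @ z), ext b (w @ z)) \<in> ideal_rel G Y"
  shows "nat_le T (\<theta> (Frac a b)) (ideal_join Y)"
proof -
  obtain B where B: "finite B" "B \<subseteq> elts (gis G)" "ideal_rel G Y = \<Union>(gis_rel G ` B)"
    using Y by (rule DD_E)
  \<comment> \<open>Only second components are measured, which suffices because a shared extension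
    ties the first component to the second. The default 0 for \<open>Zero\<close> is harmless, as
    its relation is empty.\<close>
  define len :: "('v, 'e) gis_elt \<Rightarrow> nat" where
    "len = (\<lambda>s. case s of Zero \<Rightarrow> 0 | Frac c d \<Rightarrow> length (snd d))"
  obtain N where N: "\<And>s. s \<in> B \<Longrightarrow> len s \<le> N"
    using finite_imageI[OF B(1), of len] by (meson Max_ge imageI)
  have mem: "nat_le T (\<theta> (Frac a b)) (ideal_join Y)" if "(a, b) \<in> ideal_rel G Y" for a b
    using that Y Frac_mem_DD_iff ideal_rel_path_pairs theta_le_ideal_join by blast
  from ab dense show ?thesis
  \<comment> \<open>The truncated difference drops strictly with each added edge as long as b is
    shorter than N; it is zero exactly when the expansion may stop.\<close>
  proof (induction "N - length (snd b)" arbitrary: a b rule: less_induct)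
    case less
    have v: "path_dom G a \<in> verts G" using less.prems(1) path_dom_in_verts by (simp add: path_pairs_def)
    then obtain z where z: "(ext a z, ext b z) \<in> ideal_rel G Y" using less.prems(2)[of "[]"] by auto
    then have z_path: "(path_dom G a, z) \<in> paths G" using ideal_rel_path_pairs[OF Y] by (auto simp: ext_pair_iff)
    show ?case
    proof (cases "N \<le> length (snd b)")
      case True
      obtain s where s: "s \<in> B" "(ext a z, ext b z) \<in> gis_rel G s" using z B(3) by blast
      then obtain c d where s': "s = Frac c d" by (cases s) auto
      obtain q where q: "ext a z = ext c q" "ext b z = ext d q"
        using s(2) unfolding s' gis_rel.simps by blast
      have "length (snd d) \<le> length (snd b)" using N[OF s(1)] True s' by (simp add: len_def)
      have "\<exists>r. b = ext d r \<and> q = r @ z"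
        using q(2)
      proof (cases rule: ext_eq_ext)
        \<comment> \<open>Here d would extend b although it is not longer, so the two are
          equal.\<close>
        case (left r)
        then have "r = []" using \<open>length (snd d) \<le> length (snd b)\<close> by (simp add: ext_def)
        then show ?thesis using left by simp
      qed blast
      then obtain r where r: "b = ext d r" "q = r @ z" by blast
      then have "ext a z = ext (ext c r) z" using q(1) by simp
      then have "a = ext c r" by (simp del: ext_ext)
      moreover have "a \<in> paths G" using less.prems(1) by (simp add: path_pairs_def)
      ultimately have "(a, b) \<in> gis_rel G s" using r(1) s' by simp
      then show ?thesis using mem s(1) B(3) by blast
    next
      case False
      show ?thesis
      \<comment> \<open>At in-degree 0 no relation is available, but neither is any nonempty
        extension, so density puts (a, b) itself into the relation of Y.\<close>
      proof (cases "in_arcs G (path_dom G a) = {}")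
        case True
        then have "z = []" using z_path by (cases z) auto
        then show ?thesis using mem z by simp
      next
        case ne: False
        have "nat_le T (\<theta> (Frac (ext a [f]) (ext b [f]))) (ideal_join Y)"
          if f: "f \<in> in_arcs G (path_dom G a)" for f
        proof (rule less.hyps)
          show "N - length (snd (ext b [f])) < N - length (snd b)" using False by (simp add: ext_def)
          show "(ext a [f], ext b [f]) \<in> path_pairs G"
            using less.prems(1) arc_path[OF f] by (simp add: path_pairs_def del: paths_Cons)
          \<comment> \<open>Density is assumed after every further word w precisely so that the
            extended pair inherits the hypothesis.\<close>
          fix w assume "(path_dom G (ext a [f]), w) \<in> paths G"
          then have "(path_dom G a, f # w) \<in> paths G" using f by simp
          then obtain z where "(ext a ((f # w) @ z), ext b ((f # w) @ z)) \<in> ideal_rel G Y"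
            using less.prems(2) by blast
          then show "\<exists>z. (ext (ext a [f]) (w @ z), ext (ext b [f]) (w @ z)) \<in> ideal_rel G Y" by auto
        qed
        then show ?thesis
          using theta_Frac_join[OF less.prems(1) ne] ideal_join_closed[OF Y] T.is_join_le_iff by simp
      qed
    qed
  qed
qed

lemma ideal_join_mono:
  assumes X: "X \<in> elts (DD (gis G))" and Y: "Y \<in> elts (DD (gis G))"
    and d: "dense_below (ideal_rel G X) (ideal_rel G Y)"
  shows "nat_le T (ideal_join X) (ideal_join Y)"
proof -
  have "nat_le T (\<theta> s) (ideal_join Y)" if s: "s \<in> X" for s
  proof (cases "s = Zero")
    case True
    \<comment> \<open>A homomorphism need not send zero to the zero of T; its value is bounded
      because every ideal, in particular Y, contains \<open>Zero\<close>.\<close>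
    then show ?thesis using theta_le_ideal_join[OF Y Zero_mem_DD[OF Y]] by simp
  next
    case False
    moreover have "s \<in> elts (gis G)" using mem_DD_iff[OF X] s by blast
    ultimately obtain a b where ab: "s = Frac a b" "(a, b) \<in> path_pairs G"
      by (meson Frac_exhaust_nonzero)
    then have abX: "(a, b) \<in> ideal_rel G X" using Frac_mem_DD_iff[OF X] s by blast
    show ?thesis unfolding ab(1)
    proof (rule theta_le_if_dense[OF Y ab(2)])
      fix w assume "(path_dom G a, w) \<in> paths G"
      then have "(ext a w, ext b w) \<in> ideal_rel G X" using ideal_rel_ext[OF X abX] by blast
      then show "\<exists>z. (ext a (w @ z), ext b (w @ z)) \<in> ideal_rel G Y"
        using d unfolding dense_below_def by (metis ext_ext)
    qed
  qed
  then show ?thesis using T.is_join_le_iff[OF ideal_join[OF X] ideal_join_closed[OF Y]] by simp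
qed

text \<open>The restriction fixes the values outside the carrier, without which uniqueness would
  fail for total functions. Independence of the chosen representative is
  \<open>ck_extension_class\<close>.\<close>

definition ck_extension :: "('v, 'e) gis_elt set set \<Rightarrow> 't" where
  "ck_extension = (\<lambda>c\<in>elts (CK G). ideal_join (SOME X. X \<in> elts (DD (gis G)) \<and> ck_class X = c))"

text \<open>Equivalent ideals are dense below each other, so \<open>ideal_join_mono\<close> bounds
  each join by the other, and antisymmetry in T makes them equal.\<close>

lemma ck_extension_class:
  assumes X: "X \<in> elts (DD (gis G))"
  shows "ck_extension (ck_class X) = ideal_join X"
proof -
  define Y where "Y = (SOME Y. Y \<in> elts (DD (gis G)) \<and> ck_class Y = ck_class X)"
  have Y: "Y \<in> elts (DD (gis G)) \<and> ck_class Y = ck_class X"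
    unfolding Y_def by (rule someI[of _ X]) (simp add: X)
  then have "dense_below (ideal_rel G Y) (ideal_rel G X)" "dense_below (ideal_rel G X) (ideal_rel G Y)"
    using X ck_class_eq_iff by blast+
  then have "ideal_join Y = ideal_join X"
    using X Y by (intro T.nat_le_antisym ideal_join_mono) auto
  then show ?thesis using ck_class_closed[OF X] by (simp add: ck_extension_def Y_def)
qed

lemma ck_extension_ck_map:
  assumes s: "s \<in> elts (gis G)"
  shows "ck_extension (ck_map G s) = \<theta> s"
proof -
  have "is_join T (\<theta> ` {s}) (\<theta> s)"
    using T.is_join_singleton[OF homomorphism_closed[OF hom s]] by simp
  then have "is_join T (\<theta> ` down (gis G) {s}) (\<theta> s)" using theta_join_down_iff[of "{s}"] s by simp
  then have "ideal_join (down (gis G) {s}) = \<theta> s" by (rule ideal_join_eqI)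
  then show ?thesis by (simp add: ck_map_eq ck_extension_class DD_principal[OF s])
qed

lemma ck_extension_homomorphism: "homomorphism (CK G) T ck_extension"
  by (auto simp: homomorphism_def elts_CK ck_extension_class ideal_join_closed ck_class_times
      ideal_join_times DD.rep_closed)

lemma ck_extension_distributive: "distributive_homomorphism (CK G) T ck_extension"
  unfolding distributive_homomorphism_def
proof (intro conjI allI impI ck_extension_homomorphism)
  fix A j assume A: "finite A \<and> A \<noteq> {} \<and> compatible_set (CK G) A \<and> is_join (CK G) A j"
  then have "finite A" "A \<noteq> {}" "A \<subseteq> elts (CK G)" "is_join (CK G) A j"
    by (auto simp: compatible_set_def)
  then obtain F where F: "finite F" "F \<noteq> {}" "F \<subseteq> elts (DD (gis G))" "partial_bij (\<Union>(ideal_rel G ` F))"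
    "A = ck_class ` F" "j = ck_class (\<Union>F)"
    by (rule CK_join_E)
  note U = Union_DD[OF F(1-4)]
  \<comment> \<open>An upper bound of the joins over the single ideals is the same as an upper bound
    of all values of \<open>\<theta>\<close> on their union.\<close>
  have "is_join T (ideal_join ` F) (ideal_join (\<Union>F)) \<longleftrightarrow> is_join T (\<theta> ` \<Union>F) (ideal_join (\<Union>F))"
  proof (rule T.is_join_cong)
    fix u assume u: "u \<in> elts T"
    have "nat_le T (ideal_join X) u \<longleftrightarrow> (\<forall>a\<in>\<theta> ` X. nat_le T a u)" if "X \<in> F" for X
      using T.is_join_le_iff[OF ideal_join u] that F(3) by blast
    then show "(\<forall>a\<in>ideal_join ` F. nat_le T a u) \<longleftrightarrow> (\<forall>b\<in>\<theta> ` \<Union>F. nat_le T b u)" by auto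
  qed
  moreover have "ck_extension ` A = ideal_join ` F"
    unfolding F(5) image_image using F(3) ck_extension_class by (intro image_cong) auto
  ultimately show "is_join T (ck_extension ` A) (ck_extension j)"
    using ideal_join[OF U(1)] ck_extension_class[OF U(1)] F(6) by simp
qed

end

section \<open>Generation by the image and uniqueness of the induced homomorphism\<close>

context wf_digraph
begin

lemma ck_map_generates:
  assumes "c \<in> elts (CK G)"
  obtains A where "finite A" "A \<noteq> {}" "A \<subseteq> elts (gis G)" "compatible_set (CK G) (ck_map G ` A)"
    "is_join (CK G) (ck_map G ` A) c"
proof -
  obtain X where X: "X \<in> elts (DD (gis G))" "c = ck_class X" using assms by (rule elts_CK_E)
  obtain A where A: "finite A" "A \<noteq> {}" "A \<subseteq> elts (gis G)" "X = down (gis G) A" "compatible_set (gis G) A"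
    using X(1) by (rule DD_E)
  have "compatible_set (CK G) (ck_map G ` A)"
    using CK.homomorphism_compatible_set[OF homomorphism_ck_map] gis.inverse_semigroup_axioms A(5) by blast
  then show thesis using that ck_class_join[OF A(1,2,5)] A X(2) by simp
qed

text \<open>Every class is the join of a finite compatible set of values of \<open>ck_map G\<close>.
  Such joins are preserved by f and g, which agree on that set, and joins in T are unique.\<close>

lemma distributive_homomorphism_CK_unique:
  assumes T: "inverse_semigroup T"
    and f: "distributive_homomorphism (CK G) T f" and g: "distributive_homomorphism (CK G) T g"
    and eq: "\<And>s. s \<in> elts (gis G) \<Longrightarrow> f (ck_map G s) = g (ck_map G s)"
    and c: "c \<in> elts (CK G)"
  shows "f c = g c"
proof -
  obtain A where A: "finite A" "A \<noteq> {}" "A \<subseteq> elts (gis G)" "compatible_set (CK G) (ck_map G ` A)"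
    "is_join (CK G) (ck_map G ` A) c"
    using c by (rule ck_map_generates)
  have "is_join T (f ` ck_map G ` A) (f c)" "is_join T (g ` ck_map G ` A) (g c)"
    using f g A by (simp_all add: distributive_homomorphism_def)
  moreover have "f ` ck_map G ` A = g ` ck_map G ` A"
    unfolding image_image using eq A(3) by (intro image_cong) auto
  ultimately show ?thesis using inverse_semigroup.is_join_unique[OF T] by simp
qed

end

theorem theorem3p14:
  fixes G :: "('v, 'e) pre_digraph"
  assumes graph: "wf_digraph G"
    and finite_in_degrees: "\<forall>v\<in>verts G. finite (in_arcs G v)"
  shows
    "(distributive_inverse_semigroup (CK G) \<and>
      homomorphism (gis G) (CK G) (ck_map G) \<and>
      (\<forall>c\<in>elts (CK G). \<exists>B. B \<subseteq> ck_map G ` elts (gis G) \<and> finite B \<and> B \<noteq> {} \<and>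
          compatible_set (CK G) B \<and> is_join (CK G) B c) \<and>
      (\<forall>e\<in>ck_idempotents (gis G).
          is_join (CK G) (ck_map G ` covered_by (gis G) e) (ck_map G e)) \<and>
      (inj_on (ck_map G) (elts (gis G)) \<longleftrightarrow>
          (\<forall>v\<in>verts G. in_degree G v = 0 \<or> in_degree G v \<ge> 2))) \<and>
     (\<forall>(T :: 't semigrp) \<theta>.
        distributive_inverse_semigroup T \<and> homomorphism (gis G) T \<theta> \<and>
        (\<forall>e\<in>ck_idempotents (gis G). is_join T (\<theta> ` covered_by (gis G) e) (\<theta> e)) \<longrightarrow>
        (\<exists>!\<theta>'. \<theta>' \<in> extensional (elts (CK G)) \<and>
            distributive_homomorphism (CK G) T \<theta>' \<and>
            (\<forall>s\<in>elts (gis G). \<theta>' (ck_map G s) = \<theta> s)))"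
proof -
  interpret wf_digraph G by fact
  have generates: "\<exists>B. B \<subseteq> ck_map G ` elts (gis G) \<and> finite B \<and> B \<noteq> {} \<and>
      compatible_set (CK G) B \<and> is_join (CK G) B c" if c: "c \<in> elts (CK G)" for c
  proof -
    obtain A where "finite A" "A \<noteq> {}" "A \<subseteq> elts (gis G)" "compatible_set (CK G) (ck_map G ` A)"
      "is_join (CK G) (ck_map G ` A) c"
      using c by (rule ck_map_generates)
    then show ?thesis by (intro exI[of _ "ck_map G ` A"]) auto
  qed
  have universal: "\<exists>!\<theta>'. \<theta>' \<in> extensional (elts (CK G)) \<and> distributive_homomorphism (CK G) T \<theta>' \<and>
      (\<forall>s\<in>elts (gis G). \<theta>' (ck_map G s) = \<theta> s)"
    if T: "distributive_inverse_semigroup T" and hom: "homomorphism (gis G) T \<theta>"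
      and ck: "\<forall>e\<in>ck_idempotents (gis G). is_join T (\<theta> ` covered_by (gis G) e) (\<theta> e)"
    for T :: "'t semigrp" and \<theta>
  proof -
    interpret T: distributive_inverse_semigroup T by fact
    interpret ck_representation G T \<theta>
      by unfold_locales (use hom ck finite_in_degrees in auto)
    show ?thesis
    proof (rule ex1I[of _ ck_extension])
      show "ck_extension \<in> extensional (elts (CK G)) \<and> distributive_homomorphism (CK G) T ck_extension \<and>
          (\<forall>s\<in>elts (gis G). ck_extension (ck_map G s) = \<theta> s)"
        using ck_extension_distributive ck_extension_ck_map by (simp add: ck_extension_def)
      fix \<eta> assume \<eta>: "\<eta> \<in> extensional (elts (CK G)) \<and> distributive_homomorphism (CK G) T \<eta> \<and>
          (\<forall>s\<in>elts (gis G). \<eta> (ck_map G s) = \<theta> s)"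
      show "\<eta> = ck_extension"
      proof (rule extensionalityI)
        show "\<eta> \<in> extensional (elts (CK G))" using \<eta> by blast
        show "ck_extension \<in> extensional (elts (CK G))" by (simp add: ck_extension_def)
        show "\<eta> c = ck_extension c" if "c \<in> elts (CK G)" for c
          using distributive_homomorphism_CK_unique[OF T.inverse_semigroup_axioms _ ck_extension_distributive _ that]
            \<eta> ck_extension_ck_map by simp
      qed
    qed
  qed
  show ?thesis
  proof (intro conjI ballI allI impI)
    show "distributive_inverse_semigroup (CK G)" by (rule CK.distributive_inverse_semigroup_axioms)
    show "inj_on (ck_map G) (elts (gis G)) \<longleftrightarrow> (\<forall>v\<in>verts G. in_degree G v = 0 \<or> in_degree G v \<ge> 2)"
      by (rule inj_on_ck_map_iff[OF finite_in_degrees])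
  qed (use homomorphism_ck_map generates ck_map_cuntz_krieger universal in simp_all)
qed

end
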